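(* Suppose $0<p<\infty$, $-2\le\alpha\le 0$, and $f$ is analytic in the unit disk $\mathbb{D}$. Then the function $r\mapsto M_{p,\alpha}(f,r)$ is logarithmically convex on $(0,1)$; that is, $\log M_{p,\alpha}(f,r)$ is a convex function of $\log r$. Equivalently, whenever $0<r_1<r_2<1$, $0<\theta<1$ and $r=r_1^{\theta}r_2^{1-\theta}$, one has $$M_{p,\alpha}(f,r)\le \big(M_{p,\alpha}(f,r_1)\big)^{\theta}\big(M_{p,\alpha}(f,r_2)\big)^{1-\theta}.$$
   Context: $\mathbb{D}=\{z\in\mathbb{C}:|z|<1\}$ is the open unit disk, $dA$ is area measure on $\mathbb{D}$, and $r\mathbb{D}=\{z:|z|<r\}$. For real $\alpha$, $dA_\alpha(z)=(1-|z|^2)^\alpha\,dA(z)$. For $f$ analytic in $\mathbb{D}$, $0<p<\infty$ and $0<r<1$, the area integral means are $$M_{p,\alpha}(f,r)=\frac{\int_{r\mathbb{D}}|f(z)|^p\,dA_\alpha(z)}{\int_{r\mathbb{D}}dA_\alpha(z)}.$$ A function $g(r)$ on $(0,1)$ is logarithmically convex if $\log g(r)$ is a convex function of $\log r$; for the zero function this is understood via the multiplicative inequality in the claim, which then holds trivially. *)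

theory Defs
  imports "HOL-Complex_Analysis.Complex_Analysis"
begin

text \<open>
  The weighted area measure \<open>(1 - |z|\<^sup>2)\<^sup>\<alpha> dA(z)\<close> of the open unit disk, extended by zero to
  the whole plane; \<open>dA\<close> is two-dimensional Lebesgue measure.
\<close>

definition weighted_area :: "real \<Rightarrow> complex measure" where
  "weighted_area \<alpha> =
     density lborel (\<lambda>z. indicator (ball 0 1) z * ennreal ((1 - (cmod z)\<^sup>2) powr \<alpha>))"

definition area_mean :: "real \<Rightarrow> real \<Rightarrow> (complex \<Rightarrow> complex) \<Rightarrow> real \<Rightarrow> real" where
  "area_mean p \<alpha> f r =
     (LINT z:ball 0 r|weighted_area \<alpha>. cmod (f z) powr p) / measure (weighted_area \<alpha>) (ball 0 r)"

text \<open>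
  Convexity of \<open>log g(r)\<close> as a function of \<open>t = log r\<close>, where \<open>0 < r < 1\<close> corresponds to
  \<open>t < 0\<close>. Positivity of \<open>g\<close> is required because \<open>ln\<close> is total here and carries no
  information at arguments that are not positive.
\<close>

definition logarithmically_convex :: "(real \<Rightarrow> real) \<Rightarrow> bool" where
  "logarithmically_convex g \<longleftrightarrow>
     (\<forall>r\<in>{0<..<1}. 0 < g r) \<and> convex_on {..<0} (\<lambda>t. ln (g (exp t)))"

end

theory Submission
  imports Defs
begin

text \<open>
  Put \<open>a = -\<alpha>\<close> and \<open>x = r\<^sup>2\<close>. On circles, the means of \<open>|f|\<^sup>p\<close> form a nondecreasing function \<open>m\<close>
  with Hardy's property: if \<open>m \<le> c t\<^sup>s\<close> at two points, then also in between (maximum principle for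
  \<open>|z|\<^sup>\<lambda> |f|\<^sup>p\<close>). Given \<open>x\<^sub>1 < x\<^sub>2\<close>, choose \<open>c\<close> and \<open>s \<ge> 0\<close> such that \<open>m\<close> and \<open>c t\<^sup>s\<close> have the same
  integral against \<open>(1 - t)\<^sup>-\<^sup>a dt\<close> over \<open>(0, x\<^sub>1)\<close> and over \<open>(0, x\<^sub>2)\<close>. By Hardy's property \<open>m - c t\<^sup>s\<close>
  changes sign at most twice, from positive to negative to positive, so the integral of \<open>m\<close> over
  \<open>(0, x)\<close> is at most that of \<open>c t\<^sup>s\<close> for \<open>x\<close> between \<open>x\<^sub>1\<close> and \<open>x\<^sub>2\<close>. This reduces the theorem to monomials.

  For monomials let \<open>h\<^sub>s(x)\<close> be the integral of \<open>t\<^sup>s (1 - t)\<^sup>-\<^sup>a\<close> over \<open>(0, x)\<close> and \<open>y\<^sub>s = x h\<^sub>s'/h\<^sub>s\<close>, which solves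
  the Riccati equation \<open>x y' = y (1 + s + b - y)\<close> with \<open>b = a x/(1 - x)\<close>. Differentiating once more, \<open>x (b - 2 y\<^sub>0)'\<close>
  and then \<open>x (y\<^sub>s - y\<^sub>0)'\<close> solve linear equations with nonnegative source terms, the first one
  because \<open>a \<le> 2\<close>; hence both are nonnegative, and \<open>ln (h\<^sub>s/h\<^sub>0)\<close> is convex in \<open>ln x\<close>.

  Circle means are replaced by means over rotations by \<open>n\<close>-th roots of unity, and \<open>m\<close> by their
  maximum over a circle, with an error that tends to \<open>0\<close> as \<open>n\<close> grows.
\<close>

subsection \<open>Monomials\<close>

text \<open>\<open>F\<close> is nondecreasing, so \<open>L t \<le> F t \<le> F x\<close> for
  \<open>t < x\<close>, and the left side tends to 0. The minorant \<open>L\<close> stands in for a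
  value of \<open>F\<close> at 0, where several functions below take the form 0/0.\<close>

lemma nonneg_if_deriv_nonneg:
  fixes F F' L :: "real \<Rightarrow> real"
  assumes F: "\<And>x. 0 < x \<Longrightarrow> x < 1 \<Longrightarrow> (F has_real_derivative F' x) (at x)"
    and F': "\<And>x. 0 < x \<Longrightarrow> x < 1 \<Longrightarrow> 0 \<le> F' x"
    and L: "\<And>x. 0 < x \<Longrightarrow> x < 1 \<Longrightarrow> L x \<le> F x"
    and lim: "(L \<longlongrightarrow> 0) (at_right 0)"
    and x: "0 < x" "x < 1"
  shows "0 \<le> F x"
proof (rule tendsto_upperbound[OF lim])
  show "\<forall>\<^sub>F t in at_right 0. L t \<le> F x"
    unfolding eventually_at_right_field
  proof (intro exI[of _ x] conjI allI impI)
    fix t assume t: "0 < t" "t < x"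
    have "F t \<le> F x"
      by (rule DERIV_nonneg_imp_nondecreasing[of t x F]) (use t x F F' in force)+
    then show "L t \<le> F x" using L[of t] t x by linarith
  qed (use x in auto)
qed simp

section \<open>Incomplete beta functions \<open>B(x; s + 1, 1 - a)\<close>\<close>

definition inc_beta :: "real \<Rightarrow> real \<Rightarrow> real \<Rightarrow> real" where
  "inc_beta a s x = (LINT t:{0<..<x}|lborel. t powr s * (1 - t) powr (-a))"

lemma inc_beta_integrable:
  fixes a s x :: real
  assumes "0 \<le> s" "x < 1"
  shows "set_integrable lborel {0<..<x} (\<lambda>t. t powr s * (1 - t) powr (-a))"
proof -
  \<comment> \<open>Since \<open>0 powr 0 = 0\<close>, the map \<open>t powr s\<close> jumps at 0
    when \<open>s = 0\<close>. Replacing it by 1 in that case gives a continuous integrand on the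
    closed interval.\<close>
  have "set_integrable lborel {0..x} (\<lambda>t. (if s = 0 then 1 else t powr s) * (1 - t) powr (-a))"
    by (rule borel_integrable_atLeastAtMost', cases "s = 0")
      (use assms in \<open>auto intro!: continuous_intros continuous_on_powr'\<close>)
  then have "set_integrable lborel {0<..<x} (\<lambda>t. (if s = 0 then 1 else t powr s) * (1 - t) powr (-a))"
    by (rule set_integrable_subset) auto
  then show ?thesis
    by (rule set_integrable_cong[THEN iffD1, rotated -1]) auto
qed

lemma inc_beta_has_derivative:
  assumes "0 \<le> s" "0 < x" "x < 1"
  shows "(inc_beta a s has_real_derivative x powr s * (1 - x) powr (-a)) (at x)"
proof -
  \<comment> \<open>The continuous form of the integrand permits the fundamental theorem of calculus
    on \<open>{0..c}\<close>; the choice \<open>x < c < 1\<close> makes \<open>x\<close> an interior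
    point.\<close>
  define g where "g t = (if s = 0 then 1 else t powr s) * (1 - t) powr (-a)" for t
  define c where "c = (x + 1) / 2"
  have c: "x < c" "c < 1" using assms by (auto simp: c_def)
  have g: "continuous_on {0..c} g"
    unfolding g_def by (cases "s = 0") (use assms c in \<open>auto intro!: continuous_intros continuous_on_powr'\<close>)
  have "((\<lambda>u. integral {0..u} g) has_real_derivative g x) (at x within {0..c})"
    by (rule integral_has_real_derivative[OF g]) (use assms c in auto)
  then have *: "((\<lambda>u. integral {0..u} g) has_real_derivative g x) (at x)"
    by (subst (asm) at_within_interior) (use assms c in auto)
  have eq: "integral {0..u} g = inc_beta a s u" if "0 < u" "u < 1" for u
  proof -
    have "inc_beta a s u = integral {0<..<u} (\<lambda>t. t powr s * (1 - t) powr (-a))"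
      unfolding inc_beta_def
      by (rule set_borel_integral_eq_integral(2)[OF inc_beta_integrable]) (use assms that in auto)
    also have "\<dots> = integral {0<..<u} g"
      by (rule Henstock_Kurzweil_Integration.integral_cong) (auto simp: g_def)
    finally show ?thesis by (simp add: integral_open_interval_real)
  qed
  have "(inc_beta a s has_real_derivative g x) (at x)"
    by (rule DERIV_cong_ev[THEN iffD1, OF refl _ refl *])
      (use eventually_nhds_in_open[of "{0<..<1}" x] assms eq in \<open>auto elim!: eventually_mono\<close>)
  then show ?thesis using assms by (auto simp: g_def split: if_splits)
qed

lemma inc_beta_le:
  assumes "0 \<le> a" "0 \<le> s" "0 < x" "x < 1"
  shows "inc_beta a s x \<le> x powr s * inc_beta a 0 x"
proof -
  have "inc_beta a s x \<le> (LINT t:{0<..<x}|lborel. x powr s * (t powr 0 * (1 - t) powr (-a)))"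
    unfolding inc_beta_def
  proof (rule set_integral_mono)
    fix t assume t: "t \<in> {0<..<x}"
    then have "t powr s \<le> x powr s" using assms by (intro powr_mono2) auto
    then show "t powr s * (1 - t) powr (-a) \<le> x powr s * (t powr 0 * (1 - t) powr (-a))"
      using t by (auto intro!: mult_right_mono)
  qed (use assms in \<open>auto intro!: inc_beta_integrable set_integrable_mult_right simp del: powr_zero_eq_one\<close>)
  then show ?thesis by (simp add: inc_beta_def)
qed

lemma inc_beta_0_le:
  assumes "0 \<le> a" "0 < x" "x < 1"
  shows "inc_beta a 0 x \<le> x * (1 - x) powr (-a)"
proof -
  have "inc_beta a 0 x \<le> (LINT t:{0<..<x}|lborel. (1 - x) powr (-a))"
    unfolding inc_beta_def
    by (rule set_integral_mono[OF inc_beta_integrable])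
      (use assms in \<open>auto intro!: powr_mono2' simp: set_integrable_def\<close>)
  then show ?thesis using assms by (simp add: set_lebesgue_integral_def mult.commute)
qed

lemma inc_beta_mono:
  assumes "0 \<le> s" "0 < x" "x \<le> y" "y < 1"
  shows "inc_beta a s x \<le> inc_beta a s y"
proof (rule DERIV_nonneg_imp_nondecreasing[of x y "inc_beta a s"])
  fix t assume "x \<le> t" "t \<le> y"
  then show "\<exists>d. (inc_beta a s has_real_derivative d) (at t) \<and> 0 \<le> d"
    using assms inc_beta_has_derivative[of s t a] by force
qed (use assms in auto)

lemma inc_beta_pos:
  assumes "0 \<le> s" "0 < x" "x < 1"
  shows "0 < inc_beta a s x"
proof -
  have "0 \<le> inc_beta a s (x/2)"
    by (auto simp: inc_beta_def set_lebesgue_integral_def intro!: integral_nonneg_AE AE_I2)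
  also have "inc_beta a s (x/2) < inc_beta a s x"
  proof (rule DERIV_pos_imp_increasing[of "x/2" x "inc_beta a s"])
    fix t assume "x/2 \<le> t" "t \<le> x"
    then show "\<exists>d. (inc_beta a s has_real_derivative d) (at t) \<and> 0 < d"
      using assms inc_beta_has_derivative[of s t a] by force
  qed (use assms in auto)
  finally show ?thesis .
qed

section \<open>Logarithmic slopes and their Riccati equation\<close>

text \<open>This is the derivative of \<open>ln (inc_beta a s x)\<close> with respect to
  \<open>ln x\<close>.\<close>

definition beta_slope :: "real \<Rightarrow> real \<Rightarrow> real \<Rightarrow> real" where
  "beta_slope a s x = x powr (s + 1) * (1 - x) powr (-a) / inc_beta a s x"

lemma beta_slope_pos:
  assumes "0 \<le> s" "0 < x" "x < 1"
  shows "0 < beta_slope a s x"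
  using inc_beta_pos[OF assms] assms by (simp add: beta_slope_def)

text \<open>Passing from exponent 0 to \<open>s\<close> multiplies the numerator by exactly
  \<open>x powr s\<close>, and the denominator by at most that factor, by
  \<open>inc_beta_le\<close>.\<close>

lemma beta_slope_mono_exponent:
  assumes "0 \<le> a" "0 \<le> s" "0 < x" "x < 1"
  shows "beta_slope a 0 x \<le> beta_slope a s x"
proof -
  have "beta_slope a 0 x = x powr (s + 1) * (1 - x) powr (-a) / (x powr s * inc_beta a 0 x)"
    using assms by (simp add: beta_slope_def powr_add)
  also have "\<dots> \<le> beta_slope a s x"
    unfolding beta_slope_def
    by (rule divide_left_mono[OF inc_beta_le])
      (use assms inc_beta_pos[of s x a] inc_beta_pos[of 0 x a] in auto)
  finally show ?thesis .
qed

text \<open>The slope is \<open>N / h\<close> with \<open>h = inc_beta a s\<close> and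
  \<open>N = x h'\<close>. With respect to \<open>ln x\<close>, the logarithmic derivative of
  \<open>N\<close> is \<open>1 + s + a * x / (1 - x)\<close> and that of \<open>h\<close> is the
  slope itself; their difference gives the Riccati equation.\<close>

lemma beta_slope_has_derivative:
  assumes "0 \<le> s" "0 < x" "x < 1"
  shows "(beta_slope a s has_real_derivative
    beta_slope a s x * (1 + s + a * x / (1 - x) - beta_slope a s x) / x) (at x)"
proof -
  have p: "0 < inc_beta a s x" by (rule inc_beta_pos[OF assms])
  define N where "N x = x powr (s + 1) * (1 - x) powr (-a)" for x :: real
  have N': "(N has_real_derivative N x * ((s + 1) / x + a / (1 - x))) (at x)"
    unfolding N_def[abs_def]
    apply (rule derivative_eq_intros refl | (use assms in simp; fail))+
    using assms by (simp add: field_simps powr_diff powr_add)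
  have h': "(inc_beta a s has_real_derivative N x / x) (at x)"
    using inc_beta_has_derivative[OF assms, of a] assms by (simp add: N_def powr_add)
  have "((\<lambda>x. N x / inc_beta a s x) has_real_derivative
      (N x * ((s + 1) / x + a / (1 - x)) * inc_beta a s x - N x * (N x / x))
        / (inc_beta a s x * inc_beta a s x)) (at x)"
    by (rule DERIV_divide[OF N' h']) (use p in simp)
  moreover have "(N x * ((s + 1) / x + a / (1 - x)) * inc_beta a s x - N x * (N x / x))
        / (inc_beta a s x * inc_beta a s x)
    = N x / inc_beta a s x * (1 + s + a * x / (1 - x) - N x / inc_beta a s x) / x"
    using assms p by (simp add: field_simps)
  ultimately show ?thesis
    by (simp add: beta_slope_def[abs_def] N_def)
qed

lemma tendsto_0_at_right_beta:
  fixes s a :: real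
  assumes "0 < s"
  shows "((\<lambda>x. x powr s * (1 - x) powr a) \<longlongrightarrow> 0) (at_right 0)"
proof -
  have "((\<lambda>x. x powr s * (1 - x) powr a) \<longlongrightarrow> 0 powr s * (1 - 0) powr a) (at_right 0)"
    by (intro tendsto_intros tendsto_powr') (use assms in \<open>auto simp: eventually_at_right_field intro: exI[of _ 1]\<close>)
  then show ?thesis by simp
qed

text \<open>Multiply the difference of the two sides by \<open>inc_beta a s x\<close>. In the
  derivative of the result, \<open>N'\<close> cancels against the term with the derivative of
  \<open>inc_beta\<close>, and only \<open>a / (1 - x)\<^sup>2 * inc_beta a s x\<close> remains. The
  bound says that the right-hand side of the Riccati equation is nonnegative.\<close>

lemma beta_slope_le:
  assumes "0 \<le> a" "0 \<le> s" "0 < x" "x < 1"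
  shows "beta_slope a s x \<le> 1 + s + a * x / (1 - x)"
proof -
  define N where "N x = x powr (s + 1) * (1 - x) powr (-a)" for x :: real
  have "0 \<le> (1 + s + a * x / (1 - x)) * inc_beta a s x - N x"
  proof (rule nonneg_if_deriv_nonneg[of "\<lambda>x. (1 + s + a * x / (1 - x)) * inc_beta a s x - N x"
        "\<lambda>x. a / (1 - x)\<^sup>2 * inc_beta a s x" "\<lambda>x. - N x"])
    fix x :: real assume x: "0 < x" "x < 1"
    show "0 \<le> a / (1 - x)\<^sup>2 * inc_beta a s x"
      using inc_beta_pos[OF \<open>0 \<le> s\<close> x, of a] assms by simp
    show "- N x \<le> (1 + s + a * x / (1 - x)) * inc_beta a s x - N x"
      using inc_beta_pos[OF \<open>0 \<le> s\<close> x, of a] assms x by simp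
    have N': "(N has_real_derivative N x * ((s + 1) / x + a / (1 - x))) (at x)"
      unfolding N_def[abs_def]
      apply (rule derivative_eq_intros refl | (use x in simp; fail))+
      using x by (simp add: field_simps powr_diff powr_add)
    have h': "(inc_beta a s has_real_derivative N x / x) (at x)"
      using inc_beta_has_derivative[OF \<open>0 \<le> s\<close> x, of a] x by (simp add: N_def powr_add)
    have b': "((\<lambda>x. a * x / (1 - x)) has_real_derivative a / (1 - x)\<^sup>2) (at x)"
      apply (rule derivative_eq_intros refl | (use x in simp; fail))+
      using x by (simp add: field_simps power2_eq_square)
    show "((\<lambda>x. (1 + s + a * x / (1 - x)) * inc_beta a s x - N x) has_real_derivative
        a / (1 - x)\<^sup>2 * inc_beta a s x) (at x)"
      apply (rule N' h' b' derivative_eq_intros refl | (use x in simp; fail))+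
      using x by (simp add: algebra_simps add_divide_distrib)
  next
    show "((\<lambda>x. - N x) \<longlongrightarrow> 0) (at_right 0)"
      using tendsto_minus[OF tendsto_0_at_right_beta[of "s + 1" "-a"]] assms by (simp add: N_def)
  qed (use assms in auto)
  then show ?thesis
    using inc_beta_pos[of s x a] assms by (simp add: beta_slope_def N_def field_simps)
qed

text \<open>Integrating factor for the linear equations satisfied by the derivatives of the slopes.\<close>

definition beta_factor :: "real \<Rightarrow> real \<Rightarrow> real \<Rightarrow> real" where
  "beta_factor a s x = (inc_beta a s x)\<^sup>2 * (1 - x) powr a / x powr (s + 1)"

lemma beta_factor_pos:
  assumes "0 \<le> s" "0 < x" "x < 1"
  shows "0 < beta_factor a s x"
  using inc_beta_pos[OF assms, of a] assms by (simp add: beta_factor_def)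

text \<open>With \<open>N = x powr (s + 1) * (1 - x) powr (-a)\<close> the factor is
  \<open>(inc_beta a s x)\<^sup>2 / N\<close>, and \<open>inc_beta a s x \<le> N\<close>. The bound
  supplies the limit 0 at the origin in the arguments by monotonicity below.\<close>

lemma beta_factor_le:
  assumes "0 \<le> a" "0 \<le> s" "0 < x" "x < 1"
  shows "beta_factor a s x \<le> x powr (s + 1) * (1 - x) powr (-a)"
proof -
  have "inc_beta a s x \<le> x powr s * (x * (1 - x) powr (-a))"
    using inc_beta_le[OF assms] inc_beta_0_le[of a x] assms
    by (meson mult_left_mono order_trans powr_ge_zero)
  then have "inc_beta a s x \<le> x powr (s + 1) * (1 - x) powr (-a)"
    using assms by (simp add: powr_add mult.assoc)
  then have "(inc_beta a s x)\<^sup>2 \<le> (x powr (s + 1) * (1 - x) powr (-a))\<^sup>2"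
    using inc_beta_pos[of s x a] assms by (intro power_mono) auto
  then have "beta_factor a s x \<le> (x powr (s + 1) * (1 - x) powr (-a))\<^sup>2 * (1 - x) powr a / x powr (s + 1)"
    unfolding beta_factor_def by (intro divide_right_mono mult_right_mono) auto
  also have "\<dots> = x powr (s + 1) * (1 - x) powr (-a)"
    using assms by (simp add: powr_minus field_simps power2_eq_square)
  finally show ?thesis .
qed

text \<open>The coefficient is the negative of the derivative in \<open>y\<close> of the Riccati
  right-hand side \<open>y * (1 + s + a * x / (1 - x) - y)\<close>. Linear equations obtained by
  differentiating the Riccati equation therefore keep only their source term after multiplication by
  the factor.\<close>

lemma beta_factor_has_derivative:
  assumes "0 \<le> s" "0 < x" "x < 1"
  shows "(beta_factor a s has_real_derivative
    beta_factor a s x * (2 * beta_slope a s x - a * x / (1 - x) - (s + 1)) / x) (at x)"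
proof -
  have p: "0 < inc_beta a s x" by (rule inc_beta_pos[OF assms])
  define P where "P x = (1 - x) powr a / x powr (s + 1)" for x :: real
  have P': "(P has_real_derivative P x * (- a / (1 - x) - (s + 1) / x)) (at x)"
    unfolding P_def[abs_def]
    apply (rule derivative_eq_intros refl | (use assms in simp; fail))+
    using assms by (simp add: field_simps powr_diff powr_add)
  have h': "(inc_beta a s has_real_derivative inc_beta a s x * beta_slope a s x / x) (at x)"
    using inc_beta_has_derivative[OF assms, of a] assms p by (simp add: beta_slope_def powr_add)
  have "((\<lambda>x. (inc_beta a s x)\<^sup>2 * P x) has_real_derivative
      (inc_beta a s x)\<^sup>2 * P x * (2 * beta_slope a s x - a * x / (1 - x) - (s + 1)) / x) (at x)"
    apply (rule derivative_eq_intros P' h' refl)+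
    using assms by (simp add: field_simps power2_eq_square)
  then show ?thesis by (simp add: beta_factor_def[abs_def] P_def)
qed

section \<open>Differential inequalities for the slopes\<close>

lemma linear_over_le:
  fixes a c x :: real
  assumes "0 \<le> a" "0 \<le> c" "0 < x" "x < 1"
  shows "c + a * x / (1 - x) \<le> (c + a) / (1 - x)"
proof -
  have "c * (1 - x) \<le> c" "a * x \<le> a"
    using assms by (auto intro: mult_right_le_one_le simp: mult_left_le)
  then have "(c * (1 - x) + a * x) / (1 - x) \<le> (c + a) / (1 - x)"
    using assms by (intro divide_right_mono) auto
  then show ?thesis using assms by (simp add: add_divide_distrib)
qed

text \<open>Up to a factor \<open>x\<close>, the claim is that
  \<open>a * x / (1 - x) - 2 * beta_slope a 0 x\<close> has nonnegative derivative. The difference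
  \<open>g\<close> of the two sides solves \<open>x g' = g (B - 2 y) + S\<close>, and the source
  \<open>S\<close> is nonnegative because \<open>a \<le> 2\<close>. So \<open>g\<close> times the
  integrating factor is nondecreasing, and it has a minorant tending to 0 at the origin.\<close>

lemma beta_slope_0_deriv_le:
  assumes "0 \<le> a" "a \<le> 2" "0 < x" "x < 1"
  shows "2 * beta_slope a 0 x * (1 + a * x / (1 - x) - beta_slope a 0 x) \<le> a * x / (1 - x)\<^sup>2"
proof -
  define y where "y = beta_slope a 0"
  define E where "E = beta_factor a 0"
  define g where "g x = a * x / (1 - x)\<^sup>2 - 2 * y x * (1 + a * x / (1 - x) - y x)" for x
  have "0 \<le> g x * E x"
  proof (rule nonneg_if_deriv_nonneg[of "\<lambda>x. g x * E x" "\<lambda>x. a * (2 - a) * x / (1 - x) ^ 3 * E x"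
        "\<lambda>x. - (2 * (1 + a)\<^sup>2 * (x powr 1 * (1 - x) powr (- a - 2)))"])
    fix x :: real assume x: "0 < x" "x < 1"
    have E0: "0 < E x" unfolding E_def by (rule beta_factor_pos) (use x in auto)
    show "0 \<le> a * (2 - a) * x / (1 - x) ^ 3 * E x" using E0 assms x by simp
    have y': "(y has_real_derivative y x * (1 + a * x / (1 - x) - y x) / x) (at x)"
      using beta_slope_has_derivative[of 0 x a] x by (simp add: y_def)
    have E': "(E has_real_derivative E x * (2 * y x - a * x / (1 - x) - 1) / x) (at x)"
      using beta_factor_has_derivative[of 0 x a] x by (simp add: y_def E_def)
    \<comment> \<open>Here \<open>P = x B'\<close>, and \<open>S\<close> is the remainder in
      \<open>x P' = P B + S\<close>.\<close>
    define B where "B x = 1 + a * x / (1 - x)" for x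
    define P where "P x = a * x / (1 - x)\<^sup>2" for x
    define S where "S = a * (2 - a) * x\<^sup>2 / (1 - x) ^ 3"
    \<comment> \<open>Writing \<open>v\<close> for \<open>1 - x\<close> turns the denominators into
      monomials.\<close>
    obtain v where v: "x = 1 - v" "0 < v" "v < 1" using that[of "1 - x"] x by simp
    have "(B has_real_derivative a / (1 - x)\<^sup>2) (at x)"
      unfolding B_def[abs_def]
      apply (rule derivative_eq_intros refl | (use x in simp; fail))+
      using x by (simp add: field_simps power2_eq_square)
    then have B': "(B has_real_derivative P x / x) (at x)"
      using x by (simp add: P_def)
    have P': "(P has_real_derivative (P x * B x + S) / x) (at x)"
      unfolding B_def P_def[abs_def] S_def
      apply (rule derivative_eq_intros refl | (use x in simp; fail))+
      unfolding v(1) using v(2,3) by (simp add: field_simps power2_eq_square power3_eq_cube)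
    have E'': "(E has_real_derivative E x * (2 * y x - B x) / x) (at x)"
      using E' by (simp add: B_def diff_diff_eq add_ac)
    have g_eq: "g = (\<lambda>x. P x - 2 * (y x * (B x - y x)))"
      by (auto simp: g_def P_def B_def)
    have g': "(g has_real_derivative (g x * (B x - 2 * y x) + S) / x) (at x)"
      unfolding g_eq
      apply (rule B' P' y'[folded B_def] derivative_eq_intros refl)+
      using x by (simp add: field_simps)
    have "((\<lambda>x. g x * E x) has_real_derivative S / x * E x) (at x)"
      apply (rule g' E'' derivative_eq_intros refl)+
      using x by (simp add: field_simps)
    then show "((\<lambda>x. g x * E x) has_real_derivative a * (2 - a) * x / (1 - x) ^ 3 * E x) (at x)"
      using x by (simp add: S_def power2_eq_square mult.assoc)
    have y0: "0 < y x" "y x \<le> 1 + a * x / (1 - x)"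
      using beta_slope_pos[of 0 x a] beta_slope_le[of a 0 x] assms x by (auto simp: y_def)
    \<comment> \<open>A crude bound on the negative part of \<open>g\<close>. Combined with
      \<open>beta_factor_le\<close> it gives a minorant of order \<open>x\<close> near 0.\<close>
    have "y x * (1 + a * x / (1 - x) - y x) \<le> (1 + a) / (1 - x) * ((1 + a) / (1 - x))"
      using y0 linear_over_le[of a 1 x] assms x by (intro mult_mono) auto
    moreover have "0 \<le> a * x / (1 - x)\<^sup>2" using assms x by simp
    ultimately have "- (2 * ((1 + a) / (1 - x))\<^sup>2) \<le> g x"
      unfolding g_def power2_eq_square by linarith
    then have "- (2 * (1 + a)\<^sup>2 / (1 - x)\<^sup>2) \<le> g x" by (simp add: power_divide)
    then have "- (2 * (1 + a)\<^sup>2 / (1 - x)\<^sup>2) * E x \<le> g x * E x"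
      using E0 by (intro mult_right_mono) auto
    moreover have "2 * (1 + a)\<^sup>2 / (1 - x)\<^sup>2 * E x
        \<le> 2 * (1 + a)\<^sup>2 / (1 - x)\<^sup>2 * (x powr 1 * (1 - x) powr (-a))"
      using beta_factor_le[of a 0 x] assms x by (intro mult_left_mono) (auto simp: E_def)
    moreover have "2 * (1 + a)\<^sup>2 / (1 - x)\<^sup>2 * (x powr 1 * (1 - x) powr (-a))
        = 2 * (1 + a)\<^sup>2 * (x powr 1 * (1 - x) powr (- a - 2))"
      using x by (simp add: powr_diff)
    ultimately show "- (2 * (1 + a)\<^sup>2 * (x powr 1 * (1 - x) powr (- a - 2))) \<le> g x * E x"
      by linarith
  next
    show "((\<lambda>x. - (2 * (1 + a)\<^sup>2 * (x powr 1 * (1 - x) powr (- a - 2)))) \<longlongrightarrow> 0) (at_right 0)"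
      using tendsto_minus[OF tendsto_mult_right_zero[OF tendsto_0_at_right_beta[of 1 "-a-2"]]] by simp
  qed (use assms in auto)
  moreover have "0 < E x" unfolding E_def by (rule beta_factor_pos) (use assms in auto)
  ultimately have "0 \<le> g x" by (simp add: zero_le_mult_iff)
  then show ?thesis by (simp add: g_def y_def)
qed

text \<open>Up to a factor \<open>x\<close>, this is monotonicity of \<open>y - z\<close>, the
  difference of the slopes for \<open>s\<close> and 0. The difference \<open>k\<close> of the
  Riccati right-hand sides solves \<open>x k' = k (s + B - 2 y) + k1\<close>. The source
  \<open>k1\<close> is nonnegative: \<open>y - z\<close> is multiplied by the quantity controlled in
  \<open>beta_slope_0_deriv_le\<close>, and the remaining term is \<open>s\<close> times the Riccati
  right-hand side of \<open>z\<close>.\<close>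

lemma beta_slope_diff_deriv_nonneg:
  assumes "0 \<le> a" "a \<le> 2" "0 \<le> s" "0 < x" "x < 1"
  shows "beta_slope a 0 x * (1 + a * x / (1 - x) - beta_slope a 0 x)
    \<le> beta_slope a s x * (1 + s + a * x / (1 - x) - beta_slope a s x)"
proof -
  define y where "y = beta_slope a s"
  define z where "z = beta_slope a 0"
  define E where "E = beta_factor a s"
  define k where "k x = y x * (1 + s + a * x / (1 - x) - y x) - z x * (1 + a * x / (1 - x) - z x)" for x
  define k1 where "k1 x = (y x - z x) * (a * x / (1 - x)\<^sup>2 - 2 * (z x * (1 + a * x / (1 - x) - z x)))
      + s * (z x * (1 + a * x / (1 - x) - z x))" for x
  have "0 \<le> k x * E x"
  proof (rule nonneg_if_deriv_nonneg[of "\<lambda>x. k x * E x" "\<lambda>x. k1 x / x * E x"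
        "\<lambda>x. - ((1 + s + a)\<^sup>2 * (x powr (s + 1) * (1 - x) powr (- a - 2)))"])
    fix x :: real assume x: "0 < x" "x < 1"
    have E0: "0 < E x" unfolding E_def by (rule beta_factor_pos) (use x assms in auto)
    have z0: "0 < z x" "z x \<le> 1 + a * x / (1 - x)"
      using beta_slope_pos[of 0 x a] beta_slope_le[of a 0 x] assms x by (auto simp: z_def)
    have y0: "0 < y x" "y x \<le> 1 + s + a * x / (1 - x)"
      using beta_slope_pos[of s x a] beta_slope_le[of a s x] assms x by (auto simp: y_def)
    have d0: "z x \<le> y x"
      using beta_slope_mono_exponent[of a s x] assms x by (auto simp: y_def z_def)
    have z1: "0 \<le> z x * (1 + a * x / (1 - x) - z x)" using z0 by auto
    have z2: "2 * (z x * (1 + a * x / (1 - x) - z x)) \<le> a * x / (1 - x)\<^sup>2"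
      using beta_slope_0_deriv_le[of a x] assms x by (simp add: z_def)
    have "0 \<le> k1 x" unfolding k1_def
      using d0 z1 z2 assms mult_nonneg_nonneg[OF \<open>0 \<le> s\<close> z1] by (intro add_nonneg_nonneg[OF mult_nonneg_nonneg]) auto
    then show "0 \<le> k1 x / x * E x" using E0 x by simp
    have y': "(y has_real_derivative y x * (1 + s + a * x / (1 - x) - y x) / x) (at x)"
      using beta_slope_has_derivative[of s x a] x assms by (simp add: y_def)
    have z': "(z has_real_derivative z x * (1 + a * x / (1 - x) - z x) / x) (at x)"
      using beta_slope_has_derivative[of 0 x a] x by (simp add: z_def)
    have E': "(E has_real_derivative E x * (2 * y x - a * x / (1 - x) - (s + 1)) / x) (at x)"
      using beta_factor_has_derivative[of s x a] x assms by (simp add: y_def E_def)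
    define B where "B x = 1 + a * x / (1 - x)" for x
    define P where "P x = a * x / (1 - x)\<^sup>2" for x
    have "(B has_real_derivative a / (1 - x)\<^sup>2) (at x)"
      unfolding B_def[abs_def]
      apply (rule derivative_eq_intros refl | (use x in simp; fail))+
      using x by (simp add: field_simps power2_eq_square)
    then have B': "(B has_real_derivative P x / x) (at x)"
      using x by (simp add: P_def)
    have E'': "(E has_real_derivative E x * (2 * y x - B x - s) / x) (at x)"
      using E' by (simp add: B_def diff_diff_eq add_ac)
    have k_eq: "k = (\<lambda>x. y x * (s + B x - y x) - z x * (B x - z x))"
      by (auto simp: k_def B_def algebra_simps)
    have k1_eq: "k1 x = (y x - z x) * (P x - 2 * (z x * (B x - z x))) + s * (z x * (B x - z x))"
      by (simp add: k1_def B_def P_def)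
    have y'': "(y has_real_derivative y x * (s + B x - y x) / x) (at x)"
      using y' by (simp add: B_def add_ac)
    have k': "(k has_real_derivative (k x * (s + B x - 2 * y x) + k1 x) / x) (at x)"
      unfolding k_eq k1_eq
      apply (rule B' y'' z'[folded B_def] derivative_eq_intros refl)+
      using x by (simp add: field_simps)
    show "((\<lambda>x. k x * E x) has_real_derivative k1 x / x * E x) (at x)"
      apply (rule k' E'' derivative_eq_intros refl)+
      using x by (simp add: field_simps)
    \<comment> \<open>Since \<open>k + y\<^sup>2\<close> is a sum of nonnegative terms, an upper
      bound for \<open>y\<^sup>2\<close> gives the minorant.\<close>
    have "(y x)\<^sup>2 \<le> ((1 + s + a) / (1 - x))\<^sup>2"
      using y0 linear_over_le[of a "1 + s" x] assms x by (intro power_mono) auto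
    moreover have "k x + (y x)\<^sup>2 = s * y x + (1 + a * x / (1 - x)) * (y x - z x) + (z x)\<^sup>2"
      by (simp add: k_def algebra_simps power2_eq_square diff_divide_distrib)
    moreover have "0 \<le> s * y x + (1 + a * x / (1 - x)) * (y x - z x) + (z x)\<^sup>2"
      using d0 y0 z0 assms x by (intro add_nonneg_nonneg mult_nonneg_nonneg) auto
    ultimately have "- ((1 + s + a)\<^sup>2 / (1 - x)\<^sup>2) \<le> k x" by (simp add: power_divide)
    then have "- ((1 + s + a)\<^sup>2 / (1 - x)\<^sup>2) * E x \<le> k x * E x"
      using E0 by (intro mult_right_mono) auto
    moreover have "(1 + s + a)\<^sup>2 / (1 - x)\<^sup>2 * E x
        \<le> (1 + s + a)\<^sup>2 / (1 - x)\<^sup>2 * (x powr (s + 1) * (1 - x) powr (-a))"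
      using beta_factor_le[of a s x] assms x by (intro mult_left_mono) (auto simp: E_def)
    moreover have "(1 + s + a)\<^sup>2 / (1 - x)\<^sup>2 * (x powr (s + 1) * (1 - x) powr (-a))
        = (1 + s + a)\<^sup>2 * (x powr (s + 1) * (1 - x) powr (- a - 2))"
      using x by (simp add: powr_diff)
    ultimately show "- ((1 + s + a)\<^sup>2 * (x powr (s + 1) * (1 - x) powr (- a - 2))) \<le> k x * E x"
      by linarith
  next
    show "((\<lambda>x. - ((1 + s + a)\<^sup>2 * (x powr (s + 1) * (1 - x) powr (- a - 2)))) \<longlongrightarrow> 0) (at_right 0)"
      using tendsto_minus[OF tendsto_mult_right_zero[OF tendsto_0_at_right_beta[of "s+1" "-a-2"]]] assms by simp
  qed (use assms in auto)
  moreover have "0 < E x" unfolding E_def by (rule beta_factor_pos) (use assms in auto)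
  ultimately have "0 \<le> k x" by (simp add: zero_le_mult_iff)
  then show ?thesis by (simp add: k_def y_def z_def)
qed

text \<open>In the variable \<open>u = ln x\<close> the derivative is the difference of the two
  slopes, which is nondecreasing by \<open>beta_slope_diff_deriv_nonneg\<close>.\<close>

lemma convex_on_ln_inc_beta_ratio:
  assumes "0 \<le> a" "a \<le> 2" "0 \<le> s"
  shows "convex_on {..<0} (\<lambda>u. ln (inc_beta a s (exp u)) - ln (inc_beta a 0 (exp u)))"
proof (rule convex_on_realI[where f' = "\<lambda>u. beta_slope a s (exp u) - beta_slope a 0 (exp u)"])
  fix u :: real assume "u \<in> {..<0}"
  then have u: "0 < exp u" "exp u < 1" by auto
  have D: "((\<lambda>u. ln (inc_beta a r (exp u))) has_real_derivative beta_slope a r (exp u)) (at u)" if "0 \<le> r" for r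
  proof -
    have "((\<lambda>u. inc_beta a r (exp u)) has_real_derivative
        (exp u powr r * (1 - exp u) powr (-a)) * exp u) (at u)"
      by (rule DERIV_chain2[where f = "inc_beta a r" and g = exp, OF inc_beta_has_derivative[OF that u] DERIV_exp])
    then have "((\<lambda>u. ln (inc_beta a r (exp u))) has_real_derivative
        (exp u powr r * (1 - exp u) powr (-a)) * exp u / inc_beta a r (exp u)) (at u)"
      using inc_beta_pos[OF that u, of a] by (auto intro!: derivative_eq_intros)
    then show ?thesis by (simp add: beta_slope_def powr_add mult_ac)
  qed
  show "((\<lambda>u. ln (inc_beta a s (exp u)) - ln (inc_beta a 0 (exp u))) has_real_derivative
      beta_slope a s (exp u) - beta_slope a 0 (exp u)) (at u)"
    by (intro DERIV_diff D) (use assms in auto)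
next
  fix u v :: real assume uv: "u \<in> {..<0}" "v \<in> {..<0}" "u \<le> v"
  have "beta_slope a s (exp u) - beta_slope a 0 (exp u) \<le> beta_slope a s (exp v) - beta_slope a 0 (exp v)"
  proof (rule DERIV_nonneg_imp_nondecreasing[of "exp u" "exp v" "\<lambda>x. beta_slope a s x - beta_slope a 0 x"])
    fix x :: real assume "exp u \<le> x" "x \<le> exp v"
    then have x: "0 < x" "x < 1"
      using uv by (auto intro: less_le_trans[OF exp_gt_zero] le_less_trans)
    have "((\<lambda>x. beta_slope a s x - beta_slope a 0 x) has_real_derivative
      beta_slope a s x * (1 + s + a * x / (1 - x) - beta_slope a s x) / x
      - beta_slope a 0 x * (1 + 0 + a * x / (1 - x) - beta_slope a 0 x) / x) (at x)"
      by (intro DERIV_diff beta_slope_has_derivative) (use assms x in auto)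
    moreover have "0 \<le> beta_slope a s x * (1 + s + a * x / (1 - x) - beta_slope a s x) / x
      - beta_slope a 0 x * (1 + 0 + a * x / (1 - x) - beta_slope a 0 x) / x"
      using divide_right_mono[OF beta_slope_diff_deriv_nonneg[OF assms x], of x] x by simp
    ultimately show "\<exists>d. ((\<lambda>x. beta_slope a s x - beta_slope a 0 x) has_real_derivative d) (at x) \<and> 0 \<le> d"
      by blast
  qed (use uv in auto)
  then show "beta_slope a s (exp u) - beta_slope a 0 (exp u) \<le> beta_slope a s (exp v) - beta_slope a 0 (exp v)" .
qed (auto simp: convex_connected)

lemma inc_beta_ratio_log_convex:
  assumes "0 \<le> a" "a \<le> 2" "0 \<le> s" "0 < x1" "x1 < 1" "0 < x2" "x2 < 1" "0 \<le> \<theta>" "\<theta> \<le> 1"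
    and x: "x = x1 powr \<theta> * x2 powr (1 - \<theta>)"
  shows "inc_beta a s x / inc_beta a 0 x
    \<le> (inc_beta a s x1 / inc_beta a 0 x1) powr \<theta> * (inc_beta a s x2 / inc_beta a 0 x2) powr (1 - \<theta>)"
proof -
  define F where "F u = ln (inc_beta a s (exp u)) - ln (inc_beta a 0 (exp u))" for u
  have F: "convex_on {..<0} F"
    unfolding F_def by (rule convex_on_ln_inc_beta_ratio) (use assms in auto)
  have "x = exp (\<theta> * ln x1 + (1 - \<theta>) * ln x2)"
    using assms by (simp add: x powr_def exp_add)
  have "F (\<theta> * ln x1 + (1 - \<theta>) * ln x2) \<le> \<theta> * F (ln x1) + (1 - \<theta>) * F (ln x2)"
    using convex_onD[OF F, of "1 - \<theta>" "ln x1" "ln x2"] assms by simp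
  have *: "\<theta> * ln x1 + (1 - \<theta>) * ln x2 < 0"
    using convexD[of "{..<0::real}" "ln x1" "ln x2" \<theta> "1 - \<theta>"] assms by simp
  then have x01: "0 < x" "x < 1" using \<open>x = exp _\<close> by auto
  have ratio: "inc_beta a s t / inc_beta a 0 t = exp (F (ln t))" if "0 < t" "t < 1" for t
    using that inc_beta_pos[of s t a] inc_beta_pos[of 0 t a] assms by (simp add: F_def exp_diff)
  have "inc_beta a s x / inc_beta a 0 x = exp (F (\<theta> * ln x1 + (1 - \<theta>) * ln x2))"
    using ratio[OF x01] \<open>x = exp _\<close> by simp
  also have "\<dots> \<le> exp (\<theta> * F (ln x1) + (1 - \<theta>) * F (ln x2))"
    using \<open>F _ \<le> _\<close> by simp
  also have "\<dots> = exp (F (ln x1)) powr \<theta> * exp (F (ln x2)) powr (1 - \<theta>)"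
    by (simp add: exp_add powr_def)
  finally show ?thesis using ratio assms by simp
qed

subsection \<open>Comparison with monomials\<close>

text \<open>Dominated convergence: as \<open>t < 1\<close>, the integrand with exponent 0 is a
  majorant. Continuity in \<open>s\<close> is what the intermediate value argument for the exponent
  uses.\<close>

lemma inc_beta_continuous:
  assumes "0 < x" "x < 1"
  shows "continuous_on {0..} (\<lambda>s. inc_beta a s x)"
  unfolding continuous_on_sequentially
proof (intro allI ballI impI)
  fix S :: "nat \<Rightarrow> real" and s assume s: "s \<in> {0..}" "(\<forall>n. S n \<in> {0..}) \<and> S \<longlonglongrightarrow> s"
  have "(\<lambda>n. inc_beta a (S n) x) \<longlonglongrightarrow> inc_beta a s x"
    unfolding inc_beta_def set_lebesgue_integral_def
  proof (rule integral_dominated_convergence[where w = "\<lambda>t. indicator {0<..<x} t *\<^sub>R (t powr 0 * (1 - t) powr (-a))"])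
    show "integrable lborel (\<lambda>t. indicator {0<..<x} t *\<^sub>R (t powr 0 * (1 - t) powr (-a)))"
      using inc_beta_integrable[of 0 x a] assms unfolding set_integrable_def by simp
    show "AE t in lborel. (\<lambda>n. indicator {0<..<x} t *\<^sub>R (t powr S n * (1 - t) powr - a))
        \<longlonglongrightarrow> indicator {0<..<x} t *\<^sub>R (t powr s * (1 - t) powr - a)"
      by (intro AE_I2) (use s in \<open>auto split: split_indicator intro!: tendsto_intros\<close>)
    show "AE t in lborel. norm (indicator {0<..<x} t *\<^sub>R (t powr S n * (1 - t) powr - a))
        \<le> indicator {0<..<x} t *\<^sub>R (t powr 0 * (1 - t) powr (-a))" for n
    proof (intro AE_I2)
      fix t :: real
      show "norm (indicator {0<..<x} t *\<^sub>R (t powr S n * (1 - t) powr - a))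
        \<le> indicator {0<..<x} t *\<^sub>R (t powr 0 * (1 - t) powr (-a))"
      proof (cases "t \<in> {0<..<x}")
        case True
        then have "t powr S n \<le> t powr 0"
          using assms s by (intro powr_mono') auto
        then show ?thesis using True by (auto intro: mult_right_mono simp del: powr_zero_eq_one)
      qed simp
    qed
  qed auto
  then show "((\<lambda>s. inc_beta a s x) \<circ> S) \<longlonglongrightarrow> inc_beta a s x" by (simp add: o_def)
qed

lemma set_integral_pos_Ioo:
  fixes f :: "real \<Rightarrow> real"
  assumes int: "set_integrable lborel {l<..<u} f" and "l < u"
    and pos: "\<And>t. l < t \<Longrightarrow> t < u \<Longrightarrow> 0 < f t"
  shows "0 < (LINT t:{l<..<u}|lborel. f t)"
proof -
  have nn: "AE t in lborel. 0 \<le> indicator {l<..<u} t *\<^sub>R f t"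
    by (intro AE_I2) (auto split: split_indicator intro: less_imp_le pos)
  have "0 \<le> (LINT t:{l<..<u}|lborel. f t)"
    unfolding set_lebesgue_integral_def by (rule integral_nonneg_AE[OF nn])
  moreover have "(LINT t:{l<..<u}|lborel. f t) \<noteq> 0"
  proof
    assume "(LINT t:{l<..<u}|lborel. f t) = 0"
    then have "AE t in lborel. indicator {l<..<u} t *\<^sub>R f t = 0"
      using integral_nonneg_eq_0_iff_AE[OF int[unfolded set_integrable_def] nn]
      by (simp add: set_lebesgue_integral_def)
    then have "AE t in lborel. t \<notin> {l<..<u}"
      by eventually_elim (use pos in \<open>force split: split_indicator_asm\<close>)
    then have "emeasure lborel {l<..<u} = 0"
      by (subst (asm) AE_iff_measurable[of "{l<..<u}"]) auto
    then show False using \<open>l < u\<close> by simp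
  qed
  ultimately show ?thesis by simp
qed

text \<open>Let \<open>I\<close> be the integral of the difference \<open>D\<close>; it vanishes at
  \<open>x1\<close> and \<open>x2\<close>. If \<open>I x > 0\<close>, then \<open>D u > 0\<close>
  for some \<open>u\<close> in \<open>{x1..<x}\<close> and \<open>D v < 0\<close> for some
  \<open>v\<close> in \<open>{x..<x2}\<close>. A point \<open>t < x1\<close> with
  \<open>D t \<le> 0\<close> would force \<open>D u \<le> 0\<close> by \<open>between\<close>. So
  \<open>D\<close> is positive on all of \<open>{0<..<x1}\<close>, which contradicts
  \<open>I x1 = 0\<close>.\<close>

lemma inc_beta_between:
  fixes m :: "real \<Rightarrow> real"
  assumes x: "0 < x1" "x1 < x" "x < x2" "x2 < 1" and "0 \<le> s"
    and int: "set_integrable lborel {0<..<x2} (\<lambda>t. m t * (1 - t) powr (-a))"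
    and between: "\<And>t u v. 0 < t \<Longrightarrow> t < u \<Longrightarrow> u < v \<Longrightarrow> v < 1 \<Longrightarrow> m t \<le> c * t powr s \<Longrightarrow>
      m v \<le> c * v powr s \<Longrightarrow> m u \<le> c * u powr s"
    and eq1: "(LINT t:{0<..<x1}|lborel. m t * (1 - t) powr (-a)) = c * inc_beta a s x1"
    and eq2: "(LINT t:{0<..<x2}|lborel. m t * (1 - t) powr (-a)) = c * inc_beta a s x2"
  shows "(LINT t:{0<..<x}|lborel. m t * (1 - t) powr (-a)) \<le> c * inc_beta a s x"
proof (rule ccontr)
  define D where "D t = m t * (1 - t) powr (-a) - c * (t powr s * (1 - t) powr (-a))" for t
  define I where "I y = (LINT t:{0<..<y}|lborel. D t)" for y
  have D: "set_integrable lborel {0<..<x2} D"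
    unfolding D_def using int inc_beta_integrable[OF \<open>0 \<le> s\<close> \<open>x2 < 1\<close>, of a]
    by (intro set_integral_diff set_integrable_mult_right) auto
  have sub: "set_integrable lborel A D" if "A \<subseteq> {0<..<x2}" "A \<in> sets borel" for A
    using set_integrable_subset[OF D] that by auto
  have I: "I y = (LINT t:{0<..<y}|lborel. m t * (1 - t) powr (-a)) - c * inc_beta a s y"
    if "0 < y" "y \<le> x2" for y
  proof -
    have "set_integrable lborel {0<..<y} (\<lambda>t. m t * (1 - t) powr (-a))"
      by (rule set_integrable_subset[OF int]) (use that in auto)
    moreover have "set_integrable lborel {0<..<y} (\<lambda>t. t powr s * (1 - t) powr (-a))"
      by (rule inc_beta_integrable) (use that x assms in auto)
    ultimately show ?thesis
      unfolding I_def D_def inc_beta_def by (subst set_integral_diff) (auto intro: set_integrable_mult_right)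
  qed
  have split: "I v = I u + (LINT t:{u..<v}|lborel. D t)" if "0 < u" "u < v" "v \<le> x2" for u v
  proof -
    have "{0<..<v} = {0<..<u} \<union> {u..<v}" using that by auto
    then show ?thesis
      unfolding I_def using that by (auto intro!: set_integral_Un sub)
  qed
  assume "\<not> (LINT t:{0<..<x}|lborel. m t * (1 - t) powr (-a)) \<le> c * inc_beta a s x"
  then have Ix: "0 < I x" using I[of x] x by auto
  have I1: "I x1 = 0" using I[of x1] eq1 x by auto
  have I2: "I x2 = 0" using I[of x2] eq2 x by auto
  have "\<exists>u\<in>{x1..<x}. 0 < D u"
  proof (rule ccontr)
    assume "\<not> (\<exists>u\<in>{x1..<x}. 0 < D u)"
    then have "(LINT t:{x1..<x}|lborel. D t) \<le> (LINT t:{x1..<x}|lborel. 0)"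
      using x by (intro set_integral_mono sub) (auto simp: set_integrable_def not_less)
    then show False using split[of x1 x] Ix I1 x by simp
  qed
  then obtain u where u: "u \<in> {x1..<x}" "0 < D u" by blast
  have "\<exists>v\<in>{x..<x2}. D v < 0"
  proof (rule ccontr)
    assume "\<not> (\<exists>v\<in>{x..<x2}. D v < 0)"
    then have "(LINT t:{x..<x2}|lborel. 0) \<le> (LINT t:{x..<x2}|lborel. D t)"
      using x by (intro set_integral_mono sub) (auto simp: set_integrable_def not_less)
    then show False using split[of x x2] Ix I2 x by simp
  qed
  then obtain v where v: "v \<in> {x..<x2}" "D v < 0" by blast
  have sgn: "D t \<le> 0 \<longleftrightarrow> m t \<le> c * t powr s" if "0 < t" "t < 1" for t
  proof -
    have "D t = (m t - c * t powr s) * (1 - t) powr (-a)" by (simp add: D_def algebra_simps)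
    then show ?thesis using that by (simp add: mult_le_0_iff)
  qed
  have "0 < D t" if "0 < t" "t < x1" for t
    using between[of t u v] sgn[of t] sgn[of u] sgn[of v] u v that x by fastforce
  then have "0 < I x1"
    unfolding I_def by (intro set_integral_pos_Ioo sub) (use x in auto)
  then show False using I1 by simp
qed

section \<open>Choice of the comparison monomial\<close>

lemma inc_beta_split:
  assumes "0 \<le> s" "0 < u" "u < v" "v < 1"
  shows "inc_beta a s v = inc_beta a s u + (LINT t:{u..<v}|lborel. t powr s * (1 - t) powr (-a))"
proof -
  have "{0<..<v} = {0<..<u} \<union> {u..<v}" using assms by auto
  moreover have "set_integrable lborel {0<..<v} (\<lambda>t. t powr s * (1 - t) powr (-a))"
    by (rule inc_beta_integrable) (use assms in auto)
  ultimately show ?thesis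
    unfolding inc_beta_def by (auto intro!: set_integral_Un elim!: set_integrable_subset)
qed

text \<open>For \<open>c\<close> strictly between \<open>x1\<close> and \<open>x2\<close>, the part
  of the integral over \<open>{c..<x2}\<close> is at least \<open>c powr s * d\<close> with
  \<open>d > 0\<close>, while \<open>inc_beta a s x1\<close> is at most a constant times
  \<open>x1 powr s\<close>. The quotient grows at least like \<open>(c / x1) powr s\<close>.\<close>

lemma inc_beta_quotient_unbounded:
  assumes "0 \<le> a" "0 < x1" "x1 < x2" "x2 < 1"
  obtains s where "0 \<le> s" "K \<le> inc_beta a s x2 / inc_beta a s x1"
proof -
  define c where "c = (x1 + x2) / 2"
  have c: "x1 < c" "c < x2" using assms by (auto simp: c_def)
  define d where "d = inc_beta a 0 x2 - inc_beta a 0 c"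
  have "0 < d" unfolding d_def
  proof -
    have "inc_beta a 0 c < inc_beta a 0 x2"
    proof (rule DERIV_pos_imp_increasing[of c x2 "inc_beta a 0"])
      fix t assume "c \<le> t" "t \<le> x2"
      then show "\<exists>d. (inc_beta a 0 has_real_derivative d) (at t) \<and> 0 < d"
        using assms c inc_beta_has_derivative[of 0 t a] by force
    qed (use c in auto)
    then show "0 < inc_beta a 0 x2 - inc_beta a 0 c" by simp
  qed
  obtain n where n: "K * inc_beta a 0 x1 / d < (c / x1) ^ n"
    using real_arch_pow[of "c / x1"] c assms by auto
  define s where "s = real n"
  have "inc_beta a s x1 \<le> x1 powr s * inc_beta a 0 x1"
    using inc_beta_le[of a s x1] assms by (simp add: s_def)
  moreover have "c powr s * d \<le> inc_beta a s x2"
  proof -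
    have "c powr s * d = (LINT t:{c..<x2}|lborel. c powr s * (t powr 0 * (1 - t) powr (-a)))"
      using inc_beta_split[of 0 c x2 a] c assms by (simp add: d_def del: powr_zero_eq_one)
    also have "\<dots> \<le> (LINT t:{c..<x2}|lborel. t powr s * (1 - t) powr (-a))"
    proof (rule set_integral_mono)
      have "set_integrable lborel {0<..<x2} (\<lambda>t. t powr 0 * (1 - t) powr (-a))"
        by (rule inc_beta_integrable) (use assms in auto)
      then show "set_integrable lborel {c..<x2} (\<lambda>t. c powr s * (t powr 0 * (1 - t) powr (-a)))"
        using c assms by (intro set_integrable_mult_right) (auto elim!: set_integrable_subset simp del: powr_zero_eq_one)
      have "set_integrable lborel {0<..<x2} (\<lambda>t. t powr s * (1 - t) powr (-a))"
        by (rule inc_beta_integrable) (use assms in \<open>auto simp: s_def\<close>)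
      then show "set_integrable lborel {c..<x2} (\<lambda>t. t powr s * (1 - t) powr (-a))"
        using c assms by (auto elim!: set_integrable_subset)
      fix t assume t: "t \<in> {c..<x2}"
      have "c powr s \<le> t powr s" using t c assms by (intro powr_mono2) (auto simp: s_def)
      then show "c powr s * (t powr 0 * (1 - t) powr (-a)) \<le> t powr s * (1 - t) powr (-a)"
        using t c assms by (auto intro!: mult_right_mono)
    qed
    also have "\<dots> \<le> inc_beta a s x2"
      using inc_beta_split[of s c x2 a] inc_beta_pos[of s c a] c assms by (simp add: s_def)
    finally show ?thesis .
  qed
  moreover have "K * (x1 powr s * inc_beta a 0 x1) \<le> c powr s * d"
  proof -
    have "K * inc_beta a 0 x1 \<le> (c / x1) powr s * d"
      using n \<open>0 < d\<close> c assms by (simp add: s_def powr_realpow field_simps)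
    then have "x1 powr s * (K * inc_beta a 0 x1) \<le> x1 powr s * ((c / x1) powr s * d)"
      by (intro mult_left_mono) auto
    also have "\<dots> = c powr s * d" using c assms by (simp add: powr_divide)
    finally show ?thesis by (simp add: mult_ac)
  qed
  moreover have "0 < inc_beta a s x1" "0 < inc_beta a s x2"
    using assms by (auto intro!: inc_beta_pos simp: s_def)
  ultimately have "K \<le> inc_beta a s x2 / inc_beta a s x1"
  proof (cases "0 \<le> K")
    case True
    then have "K * inc_beta a s x1 \<le> K * (x1 powr s * inc_beta a 0 x1)"
      using \<open>inc_beta a s x1 \<le> _\<close> by (rule mult_left_mono[rotated])
    also note \<open>K * (x1 powr s * inc_beta a 0 x1) \<le> c powr s * d\<close>
    also note \<open>c powr s * d \<le> inc_beta a s x2\<close>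
    finally show ?thesis using \<open>0 < inc_beta a s x1\<close> by (simp add: field_simps)
  next
    case False
    then have "K \<le> 0" by simp
    also have "0 \<le> inc_beta a s x2 / inc_beta a s x1"
      using \<open>0 < inc_beta a s x1\<close> \<open>0 < inc_beta a s x2\<close> by simp
    finally show ?thesis .
  qed
  with that[of s] show ?thesis by (simp add: s_def)
qed

text \<open>A monomial \<open>c * t powr s\<close> is fitted to the integrals of \<open>m\<close> at
  \<open>x1\<close> and \<open>x2\<close>. It dominates at \<open>x\<close> by
  \<open>inc_beta_between\<close>, and for the monomial the inequality is
  \<open>inc_beta_ratio_log_convex\<close>; the constant splits as
  \<open>c powr \<theta> * c powr (1 - \<theta>)\<close>.\<close>

theorem log_convex_quotient:
  fixes m :: "real \<Rightarrow> real" and a \<theta> x x1 x2 :: real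
  defines "I \<equiv> \<lambda>y. LINT t:{0<..<y}|lborel. m t * (1 - t) powr (-a)"
  assumes a: "0 \<le> a" "a \<le> 2"
    and x: "0 < x1" "x1 < x2" "x2 < 1" "0 < \<theta>" "\<theta> < 1" "x = x1 powr \<theta> * x2 powr (1 - \<theta>)"
    and mono: "\<And>t u. 0 < t \<Longrightarrow> t \<le> u \<Longrightarrow> u < 1 \<Longrightarrow> m t \<le> m u"
    and int: "set_integrable lborel {0<..<x2} (\<lambda>t. m t * (1 - t) powr (-a))"
    and between: "\<And>c s t u v. 0 < c \<Longrightarrow> 0 \<le> s \<Longrightarrow> 0 < t \<Longrightarrow> t < u \<Longrightarrow> u < v \<Longrightarrow> v < 1 \<Longrightarrow>
      m t \<le> c * t powr s \<Longrightarrow> m v \<le> c * v powr s \<Longrightarrow> m u \<le> c * u powr s"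
    and pos: "0 < I x1"
  shows "I x / inc_beta a 0 x \<le> (I x1 / inc_beta a 0 x1) powr \<theta> * (I x2 / inc_beta a 0 x2) powr (1 - \<theta>)"
proof -
  have xb: "x1 < x" "x < x2"
  proof -
    have "x1 = x1 powr \<theta> * x1 powr (1 - \<theta>)" using x by (simp flip: powr_add)
    also have "\<dots> < x" unfolding x(6) using x by (intro mult_strict_left_mono powr_less_mono2) auto
    finally show "x1 < x" .
    have "x < x2 powr \<theta> * x2 powr (1 - \<theta>)"
      unfolding x(6) using x by (intro mult_strict_right_mono powr_less_mono2) auto
    also have "\<dots> = x2" using x by (simp flip: powr_add)
    finally show "x < x2" .
  qed
  have b0: "0 < inc_beta a 0 y" if "0 < y" "y < 1" for y
    using inc_beta_pos[of 0 y a] that by simp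
  have int': "set_integrable lborel A (\<lambda>t. m t * (1 - t) powr (-a))" if "A \<subseteq> {0<..<x2}" "A \<in> sets borel" for A
    using set_integrable_subset[OF int] that by auto
  have beta': "set_integrable lborel A (\<lambda>t. t powr 0 * (1 - t) powr (-a))" if "A \<subseteq> {0<..<x2}" "A \<in> sets borel" for A
    using set_integrable_subset[OF inc_beta_integrable[of 0 x2 a]] that x by auto
  have un: "{0<..<x2} = {0<..<x1} \<union> {x1..<x2}" using x by auto
  have I2: "I x2 = I x1 + (LINT t:{x1..<x2}|lborel. m t * (1 - t) powr (-a))"
    unfolding I_def un by (rule set_integral_Un) (use x in \<open>auto intro!: int'\<close>)
  have b2: "inc_beta a 0 x2 = inc_beta a 0 x1 + (LINT t:{x1..<x2}|lborel. t powr 0 * (1 - t) powr (-a))"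
    by (rule inc_beta_split) (use x in auto)
  \<comment> \<open>As \<open>m\<close> is nondecreasing, \<open>m x1\<close> lies between its
    weighted averages over \<open>(0, x1)\<close> and \<open>(x1, x2)\<close>. Comparing the two
    gives \<open>le3\<close>, the lower end of the intermediate value argument, at exponent
    0.\<close>
  have "I x1 \<le> (LINT t:{0<..<x1}|lborel. m x1 * (t powr 0 * (1 - t) powr (-a)))"
    unfolding I_def
  proof (rule set_integral_mono)
    fix t assume t: "t \<in> {0<..<x1}"
    then show "m t * (1 - t) powr (-a) \<le> m x1 * (t powr 0 * (1 - t) powr (-a))"
      using x mono[of t x1] mono[of x1 t] by (auto intro!: mult_right_mono)
  qed (use x in \<open>auto intro!: int' set_integrable_mult_right beta' simp del: powr_zero_eq_one\<close>)
  then have le1: "I x1 \<le> m x1 * inc_beta a 0 x1" by (simp add: inc_beta_def)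
  have "(LINT t:{x1..<x2}|lborel. m x1 * (t powr 0 * (1 - t) powr (-a)))
      \<le> (LINT t:{x1..<x2}|lborel. m t * (1 - t) powr (-a))"
  proof (rule set_integral_mono)
    fix t assume t: "t \<in> {x1..<x2}"
    then show "m x1 * (t powr 0 * (1 - t) powr (-a)) \<le> m t * (1 - t) powr (-a)"
      using x mono[of t x1] mono[of x1 t] by (auto intro!: mult_right_mono)
  qed (use x in \<open>auto intro!: int' set_integrable_mult_right beta' simp del: powr_zero_eq_one\<close>)
  then have le2: "m x1 * (inc_beta a 0 x2 - inc_beta a 0 x1) \<le> I x2 - I x1"
    using I2 b2 by simp
  have le3: "inc_beta a 0 x2 / inc_beta a 0 x1 \<le> I x2 / I x1"
  proof -
    have "0 \<le> inc_beta a 0 x2 - inc_beta a 0 x1" using inc_beta_mono[of 0 x1 x2 a] x by simp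
    then have "I x1 * (inc_beta a 0 x2 - inc_beta a 0 x1) \<le> m x1 * inc_beta a 0 x1 * (inc_beta a 0 x2 - inc_beta a 0 x1)"
      by (rule mult_right_mono[OF le1])
    also have "\<dots> \<le> inc_beta a 0 x1 * (I x2 - I x1)"
      using mult_left_mono[OF le2, of "inc_beta a 0 x1"] b0[of x1] x by (simp add: mult_ac)
    finally show ?thesis using pos b0[of x1] x by (simp add: field_simps)
  qed
  obtain S where S: "0 \<le> S" "I x2 / I x1 \<le> inc_beta a S x2 / inc_beta a S x1"
    by (rule inc_beta_quotient_unbounded[of a x1 x2 "I x2 / I x1"]) (use a x in auto)
  \<comment> \<open>The quotient is at most \<open>I x2 / I x1\<close> at exponent 0 and at least
    that at \<open>S\<close>. Once the quotients agree, a single constant \<open>c\<close> matches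
    both integrals.\<close>
  have "\<exists>s. 0 \<le> s \<and> s \<le> S \<and> inc_beta a s x2 / inc_beta a s x1 = I x2 / I x1"
  proof (rule IVT')
    have "inc_beta a s x1 \<noteq> 0" if "s \<in> {0..S}" for s
      using inc_beta_pos[of s x1 a] that x by auto
    then show "continuous_on {0..S} (\<lambda>s. inc_beta a s x2 / inc_beta a s x1)"
      using x by (intro continuous_on_divide continuous_on_subset[OF inc_beta_continuous]) auto
  qed (use S le3 in auto)
  then obtain s where s: "0 \<le> s" "inc_beta a s x2 / inc_beta a s x1 = I x2 / I x1" by auto
  have bs: "0 < inc_beta a s y" if "0 < y" "y < 1" for y
    using inc_beta_pos[of s y a] that s by simp
  define c where "c = I x1 / inc_beta a s x1"
  have c0: "0 < c" using pos bs[of x1] x by (simp add: c_def)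
  have eq1: "I x1 = c * inc_beta a s x1" using bs[of x1] x by (simp add: c_def)
  have eq2: "I x2 = c * inc_beta a s x2" using s(2) pos bs[of x1] x by (simp add: c_def field_simps)
  have "I x \<le> c * inc_beta a s x"
    unfolding I_def
  proof (rule inc_beta_between[of x1 x x2])
    fix t u v assume "0 < t" "t < u" "u < v" "v < 1" "m t \<le> c * t powr s" "m v \<le> c * v powr s"
    then show "m u \<le> c * u powr s" by (rule between[OF c0 s(1)])
  qed (use x xb s int eq1 eq2 in \<open>auto simp: I_def\<close>)
  then have "I x / inc_beta a 0 x \<le> c * (inc_beta a s x / inc_beta a 0 x)"
    using divide_right_mono[of "I x" "c * inc_beta a s x" "inc_beta a 0 x"] b0[of x] xb x by auto
  also have "\<dots> \<le> c * ((inc_beta a s x1 / inc_beta a 0 x1) powr \<theta> * (inc_beta a s x2 / inc_beta a 0 x2) powr (1 - \<theta>))"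
    by (intro mult_left_mono inc_beta_ratio_log_convex) (use a s x c0 in auto)
  also have "\<dots> = (c * (inc_beta a s x1 / inc_beta a 0 x1)) powr \<theta> * (c * (inc_beta a s x2 / inc_beta a 0 x2)) powr (1 - \<theta>)"
  proof -
    have "c = c powr \<theta> * c powr (1 - \<theta>)" using c0 by (simp flip: powr_add)
    then show ?thesis
      using c0 bs[of x1] bs[of x2] b0[of x1] b0[of x2] x by (subst (1 2) powr_mult) auto
  qed
  finally show ?thesis by (simp add: eq1 eq2)
qed

subsection \<open>The maximum principle\<close>

text \<open>Where \<open>g j\<close> has a holomorphic logarithm,
  \<open>cmod (g j z) powr p * exp (Re (L z))\<close> is the modulus of a holomorphic function
  \<open>G j\<close>. A suitable sum \<open>\<Phi>\<close> of these satisfies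
  \<open>cmod (\<Phi> z) \<le> U L z\<close> with equality at \<open>z0\<close>, so the maximum
  modulus principle makes \<open>\<Phi>\<close> constant, and \<open>U L\<close> is squeezed between
  \<open>cmod (\<Phi> z0)\<close> and its own maximum.\<close>

lemma sum_norm_powr_locally_constant_at_max:
  fixes g :: "'j \<Rightarrow> complex \<Rightarrow> complex" and p :: real and J
  defines "U \<equiv> \<lambda>L z. (\<Sum>j\<in>J. cmod (g j z) powr p) * exp (Re (L z))"
  assumes "finite J" "0 < d"
    and g: "\<And>j. j \<in> J \<Longrightarrow> g j holomorphic_on ball z0 d"
    and L: "L holomorphic_on ball z0 d"
    and max: "\<And>z. z \<in> ball z0 d \<Longrightarrow> U L z \<le> U L z0"
  shows "\<exists>e>0. \<forall>z\<in>ball z0 e. U L z = U L z0"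
proof -
  \<comment> \<open>Functions vanishing at \<open>z0\<close> have no logarithm there. Their summands
    are 0 at \<open>z0\<close>, because \<open>0 powr p = 0\<close>, and nonnegative elsewhere, so
    dropping them only lowers \<open>U\<close>.\<close>
  define K where "K = {j \<in> J. g j z0 \<noteq> 0}"
  have "finite K" using \<open>finite J\<close> by (simp add: K_def)
  have "\<forall>\<^sub>F z in nhds z0. \<forall>j\<in>K. g j z \<noteq> 0"
  proof (intro eventually_ball_finite[OF \<open>finite K\<close>] ballI)
    fix j assume j: "j \<in> K"
    then have "continuous_on (ball z0 d) (g j)"
      using g by (auto simp: K_def intro: holomorphic_on_imp_continuous_on)
    then have "isCont (g j) z0"
      using \<open>0 < d\<close> by (simp add: continuous_on_eq_continuous_at)
    then have "(g j \<longlongrightarrow> g j z0) (nhds z0)"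
      by (simp add: continuous_at tendsto_nhds_iff)
    then show "\<forall>\<^sub>F z in nhds z0. g j z \<noteq> 0"
      by (rule tendsto_imp_eventually_ne) (use j in \<open>auto simp: K_def\<close>)
  qed
  then obtain e0 where e0: "0 < e0" "\<And>z j. z \<in> ball z0 e0 \<Longrightarrow> j \<in> K \<Longrightarrow> g j z \<noteq> 0"
    unfolding eventually_nhds_metric by (auto simp: dist_commute)
  define e where "e = min e0 d"
  have e: "0 < e" "ball z0 e \<subseteq> ball z0 d" "\<And>z j. z \<in> ball z0 e \<Longrightarrow> j \<in> K \<Longrightarrow> g j z \<noteq> 0"
    using e0 \<open>0 < d\<close> by (auto simp: e_def)
  have "\<exists>l. l holomorphic_on ball z0 e \<and> (\<forall>z\<in>ball z0 e. g j z = exp (l z))" if "j \<in> K" for j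
  proof -
    have "g j holomorphic_on ball z0 e"
      by (rule holomorphic_on_subset[OF g e(2)]) (use that in \<open>simp add: K_def\<close>)
    then show ?thesis
      by (rule contractible_imp_holomorphic_log) (use e(3) that in \<open>auto intro: convex_imp_contractible\<close>)
  qed
  then obtain l where l: "\<And>j. j \<in> K \<Longrightarrow> l j holomorphic_on ball z0 e"
      "\<And>j z. j \<in> K \<Longrightarrow> z \<in> ball z0 e \<Longrightarrow> g j z = exp (l j z)"
    by metis
  define G where "G j z = exp (of_real p * l j z + L z)" for j z
  have norm_G: "cmod (G j z) = cmod (g j z) powr p * exp (Re (L z))" if "j \<in> K" "z \<in> ball z0 e" for j z
    using l(2)[OF that] by (simp add: G_def exp_add powr_def norm_mult)
  \<comment> \<open>The conjugate signs turn every summand into a positive real number at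
    \<open>z0\<close>, which yields equality in the triangle inequality there.\<close>
  define \<Phi> where "\<Phi> z = (\<Sum>j\<in>K. cnj (sgn (G j z0)) * G j z)" for z
  have z0: "z0 \<in> ball z0 e" using e(1) by simp
  have U0: "U L z0 = (\<Sum>j\<in>K. cmod (G j z0))"
  proof -
    have "(\<Sum>j\<in>J. cmod (g j z0) powr p) = (\<Sum>j\<in>K. cmod (g j z0) powr p)"
      using \<open>finite J\<close> by (intro sum.mono_neutral_right) (auto simp: K_def)
    then show ?thesis using z0 unfolding U_def by (simp only: sum_distrib_right) (simp add: norm_G)
  qed
  have \<Phi>0: "\<Phi> z0 = of_real (U L z0)"
  proof -
    have "cnj (sgn x) * x = of_real (cmod x)" for x
    proof (cases "x = 0")
      case False
      have "cnj (sgn x) * x = of_real ((cmod x)\<^sup>2) / of_real (cmod x)"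
        unfolding complex_norm_square by (simp add: sgn_eq)
      also have "\<dots> = of_real (cmod x)" using False by (simp add: power2_eq_square)
      finally show ?thesis .
    qed simp
    then show ?thesis by (simp add: \<Phi>_def U0)
  qed
  have U_ge: "cmod (\<Phi> z) \<le> U L z" if z: "z \<in> ball z0 e" for z
  proof -
    have "cmod (\<Phi> z) \<le> (\<Sum>j\<in>K. cmod (cnj (sgn (G j z0)) * G j z))"
      unfolding \<Phi>_def by (rule norm_sum)
    also have "\<dots> \<le> (\<Sum>j\<in>K. cmod (G j z))"
      by (intro sum_mono) (auto simp: norm_mult norm_sgn)
    also have "\<dots> = (\<Sum>j\<in>K. cmod (g j z) powr p) * exp (Re (L z))"
      using z by (simp only: sum_distrib_right) (simp add: norm_G)
    also have "\<dots> \<le> U L z"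
      unfolding U_def using \<open>finite J\<close>
      by (intro mult_right_mono sum_mono2) (auto simp: K_def)
    finally show ?thesis .
  qed
  have U0_nonneg: "0 \<le> U L z0"
    unfolding U_def by (intro mult_nonneg_nonneg sum_nonneg) auto
  have "\<Phi> constant_on ball z0 e"
  proof (rule maximum_modulus_principle[where U = "ball z0 e" and \<xi> = z0])
    show "\<Phi> holomorphic_on ball z0 e"
      unfolding \<Phi>_def G_def
      by (intro holomorphic_intros l holomorphic_on_subset[OF L e(2)])
    fix z assume z: "z \<in> ball z0 e"
    then have "cmod (\<Phi> z) \<le> U L z0"
      using U_ge max e(2) by (meson order_trans subsetD)
    then show "cmod (\<Phi> z) \<le> cmod (\<Phi> z0)" using \<Phi>0 U0_nonneg by simp
  qed (use z0 in auto)
  then have \<Phi>: "\<Phi> z = \<Phi> z0" if "z \<in> ball z0 e" for z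
    using z0 that unfolding constant_on_def by metis
  have "U L z = U L z0" if z: "z \<in> ball z0 e" for z
  proof (rule antisym)
    show "U L z \<le> U L z0" using z e(2) max by auto
    show "U L z0 \<le> U L z" using U_ge[OF z] \<Phi>[OF z] \<Phi>0 U0_nonneg by simp
  qed
  with e(1) show ?thesis by blast
qed

text \<open>A point of largest modulus among all maximizers cannot be interior: this replaces the usual
  connectedness argument.\<close>

lemma maximum_on_boundary:
  fixes U :: "complex \<Rightarrow> real"
  assumes S: "compact S" "continuous_on S U" and T: "open T" "T \<subseteq> S"
    and loc: "\<And>z0. z0 \<in> T \<Longrightarrow> (\<And>z. z \<in> S \<Longrightarrow> U z \<le> U z0) \<Longrightarrow> \<exists>e>0. \<forall>z\<in>ball z0 e. U z = U z0"
    and z: "z \<in> S"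
  shows "\<exists>w\<in>S - T. U z \<le> U w"
proof -
  obtain zm where zm: "zm \<in> S" "\<And>w. w \<in> S \<Longrightarrow> U w \<le> U zm"
    using continuous_attains_sup[OF S(1) _ S(2)] z by auto
  define K where "K = S \<inter> U -` {U zm}"
  have "closed K"
    unfolding K_def by (rule continuous_closed_preimage[OF S(2) compact_imp_closed[OF S(1)]]) simp
  then have "compact K"
    using compact_Int_closed[OF S(1), of K] by (simp add: K_def Int_assoc[symmetric])
  moreover have "K \<noteq> {}" using zm by (auto simp: K_def)
  ultimately obtain z0 where z0: "z0 \<in> K" "\<And>w. w \<in> K \<Longrightarrow> cmod w \<le> cmod z0"
    using continuous_attains_sup[OF _ _ continuous_on_norm_id, of K] by blast
  have max: "U w \<le> U z0" if "w \<in> S" for w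
    using z0(1) zm(2)[OF that] by (simp add: K_def)
  have "z0 \<notin> T"
  proof
    assume "z0 \<in> T"
    from loc[OF this max] obtain e where e: "0 < e" "\<And>w. w \<in> ball z0 e \<Longrightarrow> U w = U z0" by blast
    obtain e' where e': "0 < e'" "ball z0 e' \<subseteq> T" using T(1) \<open>z0 \<in> T\<close> open_contains_ball by blast
    define \<epsilon> where "\<epsilon> = min e e' / 2"
    have \<epsilon>: "0 < \<epsilon>" "\<epsilon> < e" "\<epsilon> < e'" using e e' by (auto simp: \<epsilon>_def)
    \<comment> \<open>\<open>u\<close> points radially outward, in an arbitrary direction if
      \<open>z0 = 0\<close>. A small step along it stays among the maximizers and increases the
      modulus by \<open>\<epsilon>\<close>.\<close>
    define u where "u = (if z0 = 0 then 1 else sgn z0)"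
    define w where "w = z0 + of_real \<epsilon> * u"
    have u: "cmod u = 1" by (simp add: u_def norm_sgn)
    have "dist z0 w = \<epsilon>" using \<epsilon> u by (simp add: w_def dist_norm norm_mult)
    then have "w \<in> K"
      using e(2)[of w] subsetD[OF e'(2), of w] subsetD[OF T(2), of w] \<epsilon> z0(1) by (simp add: K_def)
    moreover have "cmod w = cmod z0 + \<epsilon>"
    proof (cases "z0 = 0")
      case False
      have "w = of_real (cmod z0 + \<epsilon>) * u"
        using False by (simp add: w_def u_def sgn_eq field_simps)
      then show ?thesis using u \<epsilon> by (simp add: norm_mult del: of_real_add)
    qed (use \<epsilon> u in \<open>simp add: w_def norm_mult\<close>)
    ultimately show False using z0(2)[of w] \<epsilon> by simp
  qed
  then show ?thesis using z0(1) max[OF z] by (intro bexI[of _ z0]) (auto simp: K_def)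
qed

section \<open>Means over roots of unity and their maxima on circles\<close>

text \<open>For fixed \<open>n\<close> this is a finite average of \<open>p\<close>-th powers of
  moduli of holomorphic functions of \<open>z\<close>, a form covered by
  \<open>sum_norm_powr_locally_constant_at_max\<close>.\<close>

definition root_mean :: "real \<Rightarrow> (complex \<Rightarrow> complex) \<Rightarrow> nat \<Rightarrow> complex \<Rightarrow> real" where
  "root_mean p f n z = (\<Sum>\<omega> | \<omega> ^ n = 1. cmod (f (\<omega> * z)) powr p) / real n"

text \<open>A root mean may still depend on the argument of \<open>z\<close>. Its maximum over the
  circle is a function of the radius alone, as the comparison on the interval requires.\<close>

definition circle_max :: "real \<Rightarrow> (complex \<Rightarrow> complex) \<Rightarrow> nat \<Rightarrow> real \<Rightarrow> real" where
  "circle_max p f n r = Sup (root_mean p f n ` sphere 0 r)"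

lemma norm_root_unity:
  fixes \<omega> :: complex
  assumes "\<omega> ^ n = 1" "0 < n"
  shows "cmod \<omega> = 1"
proof -
  have "cmod \<omega> ^ n = 1 ^ n" using assms by (simp flip: norm_power)
  then show ?thesis using assms(2) by (subst (asm) power_eq_iff_eq_base) auto
qed

lemma continuous_on_powr_norm:
  fixes f :: "complex \<Rightarrow> complex"
  assumes "f holomorphic_on S" "0 < p"
  shows "continuous_on S (\<lambda>z. cmod (f z) powr p)"
  by (intro continuous_on_powr' continuous_intros holomorphic_on_imp_continuous_on[OF assms(1)])
    (use assms in auto)

lemma holomorphic_on_rotate:
  assumes "f holomorphic_on ball 0 1" "cmod \<omega> = 1"
  shows "(\<lambda>z. f (\<omega> * z)) holomorphic_on ball 0 1"
  using assms by (intro holomorphic_on_compose[of "\<lambda>z. \<omega> * z" _ f, unfolded o_def])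
    (auto intro!: holomorphic_intros elim!: holomorphic_on_subset simp: norm_mult)

lemma continuous_on_root_mean:
  assumes "f holomorphic_on ball 0 1" "0 < p" "0 < n"
  shows "continuous_on (ball 0 1) (root_mean p f n)"
  unfolding root_mean_def
  by (intro continuous_intros continuous_on_powr_norm holomorphic_on_rotate)
    (use assms norm_root_unity in auto)

lemma
  assumes f: "f holomorphic_on ball 0 1" "0 < p" "0 < n" and r: "0 \<le> r" "r < 1"
  shows root_mean_le_circle_max: "\<And>z. cmod z = r \<Longrightarrow> root_mean p f n z \<le> circle_max p f n r"
    and circle_max_attained: "\<exists>w. cmod w = r \<and> circle_max p f n r = root_mean p f n w"
proof -
  have cont: "continuous_on (sphere 0 r) (root_mean p f n)"
    by (rule continuous_on_subset[OF continuous_on_root_mean[OF f]]) (use r in auto)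
  have "complex_of_real r \<in> sphere 0 r" using r by simp
  then have ne: "sphere 0 r \<noteq> ({} :: complex set)" by blast
  obtain w where w: "w \<in> sphere 0 r" "\<And>z. z \<in> sphere 0 r \<Longrightarrow> root_mean p f n z \<le> root_mean p f n w"
    using continuous_attains_sup[OF compact_sphere ne cont] by blast
  have *: "circle_max p f n r = root_mean p f n w"
    unfolding circle_max_def by (rule cSup_eq_maximum) (use w in auto)
  then show "\<exists>w. cmod w = r \<and> circle_max p f n r = root_mean p f n w" using w by auto
  show "\<And>z. cmod z = r \<Longrightarrow> root_mean p f n z \<le> circle_max p f n r" using * w(2) by simp
qed

lemma circle_max_nonneg:
  assumes "f holomorphic_on ball 0 1" "0 < p" "0 < n" "0 \<le> r" "r < 1"
  shows "0 \<le> circle_max p f n r"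
  using circle_max_attained[OF assms] by (auto simp: root_mean_def intro!: sum_nonneg divide_nonneg_nonneg)

text \<open>The factor \<open>exp (Re (L z))\<close> covers two weights: 1, with
  \<open>L = 0\<close>, and \<open>cmod z powr (-s)\<close>, which away from 0 is locally of this
  form with \<open>L = - s log z\<close>.\<close>

lemma root_mean_max_locally_constant:
  assumes f: "f holomorphic_on ball 0 1" "0 < p" "0 < n" and "0 < d" "ball z0 d \<subseteq> ball 0 1"
    and L: "L holomorphic_on ball z0 d"
    and max: "\<And>z. z \<in> ball z0 d \<Longrightarrow> root_mean p f n z * exp (Re (L z)) \<le> root_mean p f n z0 * exp (Re (L z0))"
  shows "\<exists>e>0. \<forall>z\<in>ball z0 e. root_mean p f n z * exp (Re (L z)) = root_mean p f n z0 * exp (Re (L z0))"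
proof -
  let ?J = "{\<omega>::complex. \<omega> ^ n = 1}"
  define V where "V z = (\<Sum>\<omega>\<in>?J. cmod (f (\<omega> * z)) powr p) * exp (Re (L z))" for z
  have V: "root_mean p f n z * exp (Re (L z)) = V z / real n" for z
    by (simp add: root_mean_def V_def)
  have "\<exists>e>0. \<forall>z\<in>ball z0 e. V z = V z0"
    unfolding V_def
  proof (rule sum_norm_powr_locally_constant_at_max[OF _ \<open>0 < d\<close> _ L])
    fix \<omega> :: complex assume "\<omega> \<in> ?J"
    then have "cmod \<omega> = 1" using norm_root_unity f(3) by simp
    then show "(\<lambda>z. f (\<omega> * z)) holomorphic_on ball z0 d"
      using holomorphic_on_subset[OF holomorphic_on_rotate[OF f(1)]] assms(5) by blast
  next
    show "finite ?J" using f(3) finite_roots_unity[of n] by simp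
    fix z assume "z \<in> ball z0 d"
    then show "(\<Sum>\<omega>\<in>?J. cmod (f (\<omega> * z)) powr p) * exp (Re (L z)) \<le> (\<Sum>\<omega>\<in>?J. cmod (f (\<omega> * z0)) powr p) * exp (Re (L z0))"
      using max[of z] f(3) unfolding V by (simp add: V_def divide_le_cancel)
  qed
  then show ?thesis unfolding V by metis
qed

text \<open>Maximum principle on the closed disk of radius \<open>r'\<close>, with weight 1.\<close>

lemma circle_max_mono:
  assumes f: "f holomorphic_on ball 0 1" "0 < p" "0 < n" and r: "0 \<le> r" "r \<le> r'" "r' < 1"
  shows "circle_max p f n r \<le> circle_max p f n r'"
proof -
  obtain z where z: "cmod z = r" "circle_max p f n r = root_mean p f n z"
    using circle_max_attained[OF f, of r] r by auto
  have "\<exists>w\<in>cball 0 r' - ball 0 r'. root_mean p f n z \<le> root_mean p f n w"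
  proof (rule maximum_on_boundary)
    show "continuous_on (cball 0 r') (root_mean p f n)"
      by (rule continuous_on_subset[OF continuous_on_root_mean[OF f]]) (use r in auto)
    fix z0 assume z0: "z0 \<in> ball 0 r'" and max: "\<And>z. z \<in> cball 0 r' \<Longrightarrow> root_mean p f n z \<le> root_mean p f n z0"
    obtain d where d: "0 < d" "ball z0 d \<subseteq> ball 0 r'"
      by (rule openE[OF open_ball z0])
    show "\<exists>e>0. \<forall>z\<in>ball z0 e. root_mean p f n z = root_mean p f n z0"
    proof -
      have "\<exists>e>0. \<forall>z\<in>ball z0 e. root_mean p f n z * exp (Re 0) = root_mean p f n z0 * exp (Re 0)"
      proof (rule root_mean_max_locally_constant[OF f d(1), where L = "\<lambda>_. 0"])
        show "ball z0 d \<subseteq> ball 0 1" using d(2) r by auto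
        fix z assume "z \<in> ball z0 d"
        then have "z \<in> cball 0 r'" using d(2) ball_subset_cball by blast
        then show "root_mean p f n z * exp (Re 0) \<le> root_mean p f n z0 * exp (Re 0)"
          using max[of z] by simp
      qed simp
      then show ?thesis by simp
    qed
  qed (use z r in auto)
  then obtain w where "cmod w = r'" "root_mean p f n z \<le> root_mean p f n w" by force
  then show ?thesis
    using root_mean_le_circle_max[OF f, of r' w] r z by simp
qed

text \<open>Hardy's argument: the root mean times \<open>cmod z powr (-s)\<close> attains its
  maximum over the closed annulus on one of the two boundary circles, and there it is at most
  \<open>c\<close>.\<close>

lemma circle_max_between:
  assumes f: "f holomorphic_on ball 0 1" "0 < p" "0 < n" and r: "0 < r1" "r1 < r" "r < r2" "r2 < 1"
    and r1: "circle_max p f n r1 \<le> c * r1 powr s" and r2: "circle_max p f n r2 \<le> c * r2 powr s"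
  shows "circle_max p f n r \<le> c * r powr s"
proof -
  define V where "V z = root_mean p f n z * cmod z powr (-s)" for z
  define S where "S = cball 0 r2 - ball (0::complex) r1"
  define T where "T = ball 0 r2 - cball (0::complex) r1"
  obtain z where z: "cmod z = r" "circle_max p f n r = root_mean p f n z"
    using circle_max_attained[OF f, of r] r by auto
  have "\<exists>w\<in>S - T. V z \<le> V w"
  proof (rule maximum_on_boundary)
    show "compact S" unfolding S_def by (intro compact_diff) auto
    have "continuous_on S (root_mean p f n)"
      by (rule continuous_on_subset[OF continuous_on_root_mean[OF f]]) (use r in \<open>auto simp: S_def\<close>)
    then show "continuous_on S V"
      unfolding V_def using r by (intro continuous_intros) (auto simp: S_def)
    show "open T" unfolding T_def by (intro open_Diff) auto
    show "T \<subseteq> S" "z \<in> S" using z r by (auto simp: S_def T_def)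
    fix z0 assume z0: "z0 \<in> T" and max: "\<And>z. z \<in> S \<Longrightarrow> V z \<le> V z0"
    obtain d where d: "0 < d" "ball z0 d \<subseteq> T" using z0 \<open>open T\<close> open_contains_ball by blast
    have nz: "z \<noteq> 0" if "z \<in> ball z0 d" for z
    proof -
      have "z \<in> T" using d(2) that by blast
      then show ?thesis using r by (auto simp: T_def)
    qed
    \<comment> \<open>The disk around \<open>z0\<close> avoids 0, so \<open>z\<close> has a
      holomorphic logarithm on it and the weight becomes \<open>exp (Re (L z))\<close>.\<close>
    obtain l where l: "l holomorphic_on ball z0 d" "\<And>z. z \<in> ball z0 d \<Longrightarrow> z = exp (l z)"
      by (rule contractible_imp_holomorphic_log[of "\<lambda>z. z" "ball z0 d"])
        (use nz in \<open>auto intro: convex_imp_contractible holomorphic_intros\<close>)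
    define L where "L z = - of_real s * l z" for z
    have L: "L holomorphic_on ball z0 d" unfolding L_def by (intro holomorphic_intros l)
    have V: "V z = root_mean p f n z * exp (Re (L z))" if "z \<in> ball z0 d" for z
    proof -
      have "cmod z = exp (Re (l z))" using l(2)[OF that] by (metis norm_exp_eq_Re)
      then show ?thesis by (simp add: V_def L_def powr_def)
    qed
    have z0': "z0 \<in> ball z0 d" using d by simp
    have sub: "ball z0 d \<subseteq> ball 0 1" using d(2) r by (auto simp: T_def)
    have "\<exists>e>0. \<forall>z\<in>ball z0 e. root_mean p f n z * exp (Re (L z)) = root_mean p f n z0 * exp (Re (L z0))"
    proof (rule root_mean_max_locally_constant[OF f d(1) sub L])
      fix z assume "z \<in> ball z0 d"
      then show "root_mean p f n z * exp (Re (L z)) \<le> root_mean p f n z0 * exp (Re (L z0))"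
        using max[of z] subsetD[OF d(2), of z] \<open>T \<subseteq> S\<close> V[of z] V[OF z0'] by auto
    qed
    then obtain e where e: "0 < e" "\<And>z. z \<in> ball z0 e \<Longrightarrow>
      root_mean p f n z * exp (Re (L z)) = root_mean p f n z0 * exp (Re (L z0))" by blast
    have "V z = V z0" if "z \<in> ball z0 (min e d)" for z
      using e(2)[of z] V[of z] V[OF z0'] that by simp
    then show "\<exists>e>0. \<forall>z\<in>ball z0 e. V z = V z0"
      using e(1) d(1) by (meson min_less_iff_conj)
  qed
  then obtain w where w: "w \<in> S - T" "V z \<le> V w" by blast
  have cmul: "x * y powr (-s) \<le> c \<longleftrightarrow> x \<le> c * y powr s" if "0 < y" for x y :: real
    using that by (simp add: powr_minus field_simps)
  have "V w \<le> c"
  proof -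
    have "cmod w = r1 \<or> cmod w = r2" using w(1) r by (auto simp: S_def T_def)
    then show ?thesis
      using r1 r2 r root_mean_le_circle_max[OF f, of "cmod w" w] unfolding V_def
      by (subst cmul) auto
  qed
  then have "V z \<le> c" using w(2) by simp
  then show ?thesis unfolding V_def z(2) using cmul[of "cmod z"] z(1) r by simp
qed

section \<open>Closeness of root means and circle maxima\<close>

lemma root_mean_rotate:
  assumes "\<zeta> ^ n = 1" "0 < n"
  shows "root_mean p f n (\<zeta> * z) = root_mean p f n z"
proof -
  have "\<zeta> \<noteq> 0" using assms by (auto simp: power_0_left split: if_splits)
  have "(\<Sum>\<omega> | \<omega> ^ n = 1. cmod (f (\<omega> * (\<zeta> * z))) powr p) = (\<Sum>\<omega> | \<omega> ^ n = 1. cmod (f (\<omega> * z)) powr p)"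
    by (rule sum.reindex_bij_witness[of _ "\<lambda>\<omega>. \<omega> / \<zeta>" "\<lambda>\<omega>. \<omega> * \<zeta>"])
      (use assms \<open>\<zeta> \<noteq> 0\<close> in \<open>auto simp: power_mult_distrib power_divide mult.assoc\<close>)
  then show ?thesis by (simp add: root_mean_def)
qed

text \<open>The angle of \<open>c\<close> is rounded down to a multiple of
  \<open>2 * pi / n\<close>, and a chord is no longer than its arc.\<close>

lemma root_unity_near:
  fixes c :: complex
  assumes "cmod c = 1" "0 < n"
  shows "\<exists>\<zeta>. \<zeta> ^ n = 1 \<and> cmod (\<zeta> - c) \<le> 2 * pi / real n"
proof -
  define t where "t = Arg2pi c"
  have t: "c = exp (\<i> * of_real t)"
    unfolding t_def by (rule complex_norm_eq_1_exp[THEN iffD1, OF assms(1), symmetric])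
  define k where "k = \<lfloor>real n * t / (2 * pi)\<rfloor>"
  define a where "a = 2 * pi * real_of_int k / real n"
  define \<zeta> where "\<zeta> = exp (\<i> * of_real a)"
  have "\<zeta> ^ n = exp (of_nat n * (\<i> * of_real a))" by (simp add: \<zeta>_def exp_of_nat_mult)
  also have "of_nat n * (\<i> * of_real a) = (2 * of_int k * pi) * \<i>"
    using assms(2) by (simp add: a_def field_simps)
  also have "exp \<dots> = 1" by (rule exp_integer_2pi) simp
  finally have "\<zeta> ^ n = 1" .
  have "real n * t / (2 * pi) - 1 < k" "k \<le> real n * t / (2 * pi)" unfolding k_def by linarith+
  then have ta: "0 \<le> t - a" "t - a \<le> 2 * pi / real n"
  proof -
    have "t - a = (real n * t - 2 * pi * k) / real n" using assms(2) by (simp add: a_def field_simps)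
    moreover have "0 \<le> real n * t - 2 * pi * k" "real n * t - 2 * pi * k \<le> 2 * pi"
      using \<open>real n * t / (2 * pi) - 1 < k\<close> \<open>k \<le> real n * t / (2 * pi)\<close> pi_gt_zero
      by (auto simp: field_simps)
    ultimately show "0 \<le> t - a" "t - a \<le> 2 * pi / real n"
      by (auto intro: divide_right_mono)
  qed
  have "c = \<zeta> * exp (\<i> * of_real (t - a))"
    by (simp add: t \<zeta>_def algebra_simps flip: exp_add)
  then have "c - \<zeta> = \<zeta> * (exp (\<i> * of_real (t - a)) - 1)" by (simp add: algebra_simps)
  then have "cmod (\<zeta> - c) = cmod (exp (\<i> * of_real (t - a)) - 1)"
    using norm_root_unity[OF \<open>\<zeta> ^ n = 1\<close> assms(2)] by (simp only: norm_minus_commute[of \<zeta>] norm_mult)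
  also have "\<dots> = 2 * \<bar>sin ((t - a) / 2)\<bar>" by (rule dist_exp_i_1)
  also have "\<dots> \<le> 2 * \<bar>(t - a) / 2\<bar>" by (intro mult_left_mono abs_sin_x_le_abs_x) simp
  also have "\<dots> \<le> 2 * pi / real n" using ta by simp
  finally show ?thesis using \<open>\<zeta> ^ n = 1\<close> by blast
qed

text \<open>The maximizer \<open>w\<close> on the circle through \<open>z\<close> is
  \<open>c * z\<close> with \<open>cmod c = 1\<close>. For large \<open>n\<close> some root of unity
  \<open>\<zeta>\<close> is close to \<open>c\<close>. The root mean at \<open>\<zeta> * z\<close>
  equals the one at \<open>z\<close>, and by uniform continuity of \<open>cmod (f z) powr p\<close>
  it differs little from the one at \<open>w\<close>. The same \<open>n\<close> serves all
  \<open>z\<close> in the disk.\<close>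

lemma circle_max_le_root_mean:
  assumes f: "f holomorphic_on ball 0 1" "0 < p" and r: "r < 1" and "0 < \<epsilon>"
  shows "\<exists>n>0. \<forall>z. cmod z \<le> r \<longrightarrow> circle_max p f n (cmod z) \<le> root_mean p f n z + \<epsilon>"
proof -
  define F where "F z = cmod (f z) powr p" for z
  have "continuous_on (cball 0 r) F"
    unfolding F_def by (rule continuous_on_powr_norm[OF holomorphic_on_subset[OF f(1)] f(2)]) (use r in auto)
  then have "uniformly_continuous_on (cball 0 r) F"
    by (intro compact_uniformly_continuous) auto
  then obtain \<delta> where \<delta>: "0 < \<delta>" "\<And>z w. z \<in> cball 0 r \<Longrightarrow> w \<in> cball 0 r \<Longrightarrow> dist w z < \<delta> \<Longrightarrow> dist (F w) (F z) < \<epsilon>"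
    using \<open>0 < \<epsilon>\<close> unfolding uniformly_continuous_on_def by (meson that)
  obtain n where n: "0 < n" "2 * pi / real n < \<delta>"
  proof -
    obtain n where "2 * pi / \<delta> < real n" using reals_Archimedean2 by blast
    moreover have "0 < 2 * pi / \<delta>" using \<delta>(1) by simp
    ultimately have "0 < real n" by linarith
    then show ?thesis using that[of n] \<open>2 * pi / \<delta> < real n\<close> \<delta>(1) by (simp add: field_simps)
  qed
  have "circle_max p f n (cmod z) \<le> root_mean p f n z + \<epsilon>" if z: "cmod z \<le> r" for z
  proof -
    obtain w where w: "cmod w = cmod z" "circle_max p f n (cmod z) = root_mean p f n w"
      using circle_max_attained[OF f n(1), of "cmod z"] z r by auto
    obtain c where c: "cmod c = 1" "w = c * z"
    proof (cases "z = 0")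
      case True
      then show ?thesis using that[of 1] w by simp
    next
      case False
      then show ?thesis using that[of "w / z"] w by (simp add: norm_divide)
    qed
    obtain \<zeta> where \<zeta>: "\<zeta> ^ n = 1" "cmod (\<zeta> - c) \<le> 2 * pi / real n"
      using root_unity_near[OF c(1) n(1)] by auto
    have card: "card {\<omega>::complex. \<omega> ^ n = 1} = n" using n(1) by (intro card_roots_unity_eq) auto
    \<comment> \<open>The two arguments of \<open>F\<close> have distance
      \<open>cmod (\<zeta> - c) * cmod z\<close>, which is below \<open>\<delta>\<close>.\<close>
    have "F (\<omega> * w) \<le> F (\<omega> * (\<zeta> * z)) + \<epsilon>" if \<omega>: "\<omega> ^ n = 1" for \<omega>
    proof -
      have "cmod \<omega> = 1" "cmod \<zeta> = 1" using norm_root_unity n(1) \<omega> \<zeta> by auto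
      moreover have "dist (\<omega> * w) (\<omega> * (\<zeta> * z)) < \<delta>"
      proof -
        have "\<omega> * w - \<omega> * (\<zeta> * z) = \<omega> * (c - \<zeta>) * z" by (simp add: c algebra_simps)
        then have "dist (\<omega> * w) (\<omega> * (\<zeta> * z)) = cmod (\<zeta> - c) * cmod z"
          using \<open>cmod \<omega> = 1\<close> by (simp add: dist_norm norm_mult norm_minus_commute)
        also have "\<dots> \<le> cmod (\<zeta> - c) * 1" using z r by (intro mult_left_mono) auto
        finally show ?thesis using \<zeta>(2) n(2) by simp
      qed
      ultimately have "dist (F (\<omega> * w)) (F (\<omega> * (\<zeta> * z))) < \<epsilon>"
        using z w by (intro \<delta>(2)) (auto simp: norm_mult)
      then show ?thesis by (simp add: dist_real_def)
    qed
    then have "(\<Sum>\<omega> | \<omega> ^ n = 1. F (\<omega> * w)) \<le> (\<Sum>\<omega> | \<omega> ^ n = 1. F (\<omega> * (\<zeta> * z)) + \<epsilon>)"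
      by (intro sum_mono) auto
    then have "root_mean p f n w \<le> root_mean p f n (\<zeta> * z) + \<epsilon>"
      using n(1) card by (simp add: root_mean_def F_def sum.distrib field_simps)
    then show ?thesis using w root_mean_rotate[OF \<zeta>(1) n(1)] by simp
  qed
  then show ?thesis using n(1) by blast
qed

subsection \<open>Rotation invariance and radial integrals\<close>

text \<open>It suffices to test boxes. The preimage of a box under \<open>T\<close> is its image
  under the inverse, which is orthogonal as well and preserves Lebesgue measure.\<close>

lemma distr_lborel_orthogonal:
  fixes T :: "real ^ 'n::{finite,wellorder} \<Rightarrow> real ^ 'n::_"
  assumes T: "orthogonal_transformation T"
  shows "distr lborel borel T = lborel"
proof (rule lborel_eqI[symmetric])
  have T_meas: "T \<in> borel_measurable lborel"
    using orthogonal_transformation_linear[OF T]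
    by (simp add: borel_measurable_continuous_onI linear_continuous_on linear_conv_bounded_linear)
  fix l u :: "real ^ 'n::_" assume "\<And>b. b \<in> Basis \<Longrightarrow> l \<bullet> b \<le> u \<bullet> b"
  then have box: "emeasure lborel (box l u) = (\<Prod>b\<in>Basis. (u - l) \<bullet> b)"
    by (rule emeasure_lborel_box)
  define S where "S = inv T"
  have S: "orthogonal_transformation S"
    unfolding S_def by (rule orthogonal_transformation_inv[OF T])
  have "bij T" by (rule orthogonal_transformation_bij[OF T])
  have bl: "box l u \<in> lmeasurable" by simp
  have pre: "T -` box l u = S ` box l u"
    unfolding S_def by (rule bij_vimage_eq_inv_image[OF \<open>bij T\<close>])
  have "T -` box l u \<in> sets borel" using measurable_sets[OF T_meas, of "box l u"] by simp
  then have "emeasure lborel (T -` box l u) = emeasure lebesgue (S ` box l u)"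
    by (simp add: pre)
  also have "\<dots> = ennreal (measure lebesgue (S ` box l u))"
    using measurable_orthogonal_image[OF S bl] by (simp add: emeasure_eq_measure2)
  also have "\<dots> = ennreal (measure lebesgue (box l u))"
    by (simp add: measure_orthogonal_image[OF S bl])
  also have "\<dots> = emeasure lborel (box l u)"
    using bl by (simp flip: emeasure_eq_measure2)
  finally show "emeasure (distr lborel borel T) (box l u) = (\<Prod>b\<in>Basis. (u - l) \<bullet> b)"
    using T_meas box by (simp add: emeasure_distr)
qed simp

text \<open>The coordinate map pulls boxes back to boxes with the same side lengths. It transfers
  invariance under orthogonal maps from \<open>real ^ 2\<close> to the complex plane.\<close>

lemma distr_lborel_complex:
  "distr lborel borel (\<lambda>v::real^2. Complex (v $ 1) (v $ 2)) = lborel"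
proof (rule lborel_eqI[symmetric])
  have meas: "(\<lambda>v::real^2. Complex (v $ 1) (v $ 2)) \<in> borel_measurable lborel"
    by (simp add: Complex_eq borel_measurable_continuous_onI continuous_intros)
  fix l u :: complex assume le: "\<And>b. b \<in> Basis \<Longrightarrow> l \<bullet> b \<le> u \<bullet> b"
  have "Re l \<le> Re u" "Im l \<le> Im u" using le[of 1] le[of \<i>] by (auto simp: Basis_complex_def)
  define l' u' :: "real ^ 2" where "l' = vector [Re l, Im l]" and "u' = vector [Re u, Im u]"
  have le': "l' $ i \<le> u' $ i" for i
    using exhaust_2[of i] \<open>Re l \<le> Re u\<close> \<open>Im l \<le> Im u\<close> by (auto simp: l'_def u'_def)
  have "(\<lambda>v::real^2. Complex (v $ 1) (v $ 2)) -` box l u = box l' u'"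
    by (auto simp: box_def Basis_complex_def Basis_vec_def l'_def u'_def inner_axis forall_2)
  then have "emeasure (distr lborel borel (\<lambda>v::real^2. Complex (v $ 1) (v $ 2))) (box l u) = emeasure lborel (box l' u')"
    using meas by (simp add: emeasure_distr)
  also have "\<dots> = (\<Prod>b\<in>Basis. (u' - l') \<bullet> b)"
    by (rule emeasure_lborel_box)
      (use le' in \<open>auto simp: Basis_vec_def inner_axis\<close>)
  also have "(\<Prod>b\<in>Basis. (u' - l') \<bullet> b) = (\<Prod>i\<in>UNIV. (u' - l') $ i)"
    by (rule prod.reindex_bij_witness[of _ "\<lambda>i. axis i 1" "\<lambda>b. SOME i. b = axis i 1"])
      (auto simp: Basis_vec_def inner_axis axis_eq_axis)
  also have "\<dots> = (\<Prod>b\<in>Basis. (u - l) \<bullet> b)"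
    by (simp add: UNIV_2 Basis_complex_def l'_def u'_def)
  finally show "emeasure (distr lborel borel (\<lambda>v::real^2. Complex (v $ 1) (v $ 2))) (box l u) = (\<Prod>b\<in>Basis. (u - l) \<bullet> b)" .
qed simp

text \<open>In coordinates, multiplication by \<open>\<omega>\<close> is the orthogonal map
  \<open>T\<close>; the measure is pushed around the commuting square formed by
  \<open>\<phi>\<close>, \<open>T\<close> and the multiplication.\<close>

lemma distr_lborel_rotation:
  fixes \<omega> :: complex
  assumes "cmod \<omega> = 1"
  shows "distr lborel borel (\<lambda>z. \<omega> * z) = lborel"
proof -
  define \<phi> where "\<phi> v = Complex (v $ 1) (v $ 2)" for v :: "real^2"
  define T :: "real^2 \<Rightarrow> real^2" where
    "T v = vector [Re \<omega> * v $ 1 - Im \<omega> * v $ 2, Re \<omega> * v $ 2 + Im \<omega> * v $ 1]" for v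
  have "(Re \<omega>)\<^sup>2 + (Im \<omega>)\<^sup>2 = 1" using assms by (simp add: cmod_def)
  have lin: "linear T" by (rule linearI) (auto simp: T_def vec_eq_iff forall_2 algebra_simps)
  have "norm (T v) = norm v" for v
  proof -
    have "(Re \<omega> * v $ 1 - Im \<omega> * v $ 2)\<^sup>2 + (Re \<omega> * v $ 2 + Im \<omega> * v $ 1)\<^sup>2
      = ((Re \<omega>)\<^sup>2 + (Im \<omega>)\<^sup>2) * ((v $ 1)\<^sup>2 + (v $ 2)\<^sup>2)"
      by (simp add: algebra_simps power2_eq_square)
    then show ?thesis
      using \<open>(Re \<omega>)\<^sup>2 + (Im \<omega>)\<^sup>2 = 1\<close> by (simp add: norm_vec_def L2_set_def UNIV_2 T_def)
  qed
  with lin have T: "orthogonal_transformation T" by (simp add: orthogonal_transformation)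
  have \<phi>_meas: "\<phi> \<in> borel_measurable borel"
    unfolding \<phi>_def by (simp add: Complex_eq borel_measurable_continuous_onI continuous_intros)
  have T_meas: "T \<in> borel_measurable borel"
    using lin by (simp add: borel_measurable_continuous_onI linear_continuous_on linear_conv_bounded_linear)
  have \<omega>_meas: "(\<lambda>z. \<omega> * z) \<in> borel_measurable borel" by measurable
  have comm: "(\<lambda>z. \<omega> * z) \<circ> \<phi> = \<phi> \<circ> T"
    by (auto simp: fun_eq_iff \<phi>_def T_def complex_eq_iff)
  have "distr lborel borel (\<lambda>z. \<omega> * z) = distr (distr lborel borel \<phi>) borel (\<lambda>z. \<omega> * z)"
    using distr_lborel_complex by (simp add: \<phi>_def[abs_def])
  also have "\<dots> = distr lborel borel (\<phi> \<circ> T)"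
    using distr_distr[of "\<lambda>z. \<omega> * z" borel borel \<phi> lborel] \<phi>_meas \<omega>_meas comm by simp
  also have "\<dots> = distr (distr lborel borel T) borel \<phi>"
    using distr_distr[of \<phi> borel borel T lborel] \<phi>_meas T_meas by simp
  also have "\<dots> = lborel"
    using distr_lborel_complex by (simp add: distr_lborel_orthogonal[OF T] \<phi>_def[abs_def])
  finally show ?thesis .
qed

section \<open>Radial integrals in the plane\<close>

lemma emeasure_annulus:
  assumes "0 \<le> s" "s < r"
  shows "emeasure lborel (ball (0::complex) r - cball 0 s) = ennreal (pi * (r\<^sup>2 - s\<^sup>2))"
proof -
  have "emeasure lborel (ball (0::complex) r - cball 0 s) = emeasure lborel (ball (0::complex) r) - emeasure lborel (cball (0::complex) s)"
    by (rule emeasure_Diff) (use assms in \<open>auto simp: emeasure_cball\<close>)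
  also have "\<dots> = ennreal (pi * r\<^sup>2) - ennreal (pi * s\<^sup>2)"
    using assms by (simp add: emeasure_ball emeasure_cball unit_ball_vol_2)
  also have "\<dots> = ennreal (pi * (r\<^sup>2 - s\<^sup>2))"
    using assms by (subst ennreal_minus) (auto simp: algebra_simps)
  finally show ?thesis .
qed

text \<open>For \<open>0 \<le> x < r\<^sup>2\<close> the set where
  \<open>x < (cmod z)\<^sup>2 < r\<^sup>2\<close> is an annulus of area
  \<open>pi * (r\<^sup>2 - x)\<close>, linear in \<open>x\<close>. Finite values on the half-lines
  \<open>{x<..}\<close> determine the measure.\<close>

lemma distr_ball_norm_square:
  assumes "0 < r"
  shows "distr (density lborel (indicator (ball (0::complex) r))) borel (\<lambda>z. (cmod z)\<^sup>2)
    = density lborel (\<lambda>t. ennreal (pi * indicator {0<..<r\<^sup>2} t))" (is "?M = ?N")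
proof (rule measure_eqI_lessThan)
  have M: "emeasure ?M {x<..} = emeasure lborel (ball (0::complex) r \<inter> {z. x < (cmod z)\<^sup>2})" for x
  proof -
    have ball: "ball (0::complex) r \<in> sets lborel" by simp
    have pre: "{z::complex. x < (cmod z)\<^sup>2} \<in> sets lborel" by measurable
    have "emeasure ?M {x<..} = emeasure (density lborel (indicator (ball (0::complex) r))) {z. x < (cmod z)\<^sup>2}"
      by (subst emeasure_distr) (auto simp: vimage_def)
    also have "\<dots> = (\<integral>\<^sup>+z. indicator (ball 0 r) z * indicator {z. x < (cmod z)\<^sup>2} z \<partial>lborel)"
      by (rule emeasure_density[OF borel_measurable_indicator[OF ball] pre])
    also have "\<dots> = emeasure lborel (ball 0 r \<inter> {z. x < (cmod z)\<^sup>2})"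
      unfolding indicator_inter_arith[symmetric] by (rule nn_integral_indicator) (use ball pre in auto)
    finally show ?thesis .
  qed
  have N: "emeasure ?N {x<..} = ennreal pi * emeasure lborel ({0<..<r\<^sup>2} \<inter> {x<..})" for x
  proof -
    have "emeasure ?N {x<..} = (\<integral>\<^sup>+t. ennreal pi * indicator ({0<..<r\<^sup>2} \<inter> {x<..}) t \<partial>lborel)"
      by (subst emeasure_density) (auto intro!: nn_integral_cong split: split_indicator)
    then show ?thesis by (simp add: nn_integral_cmult)
  qed
  have eq: "emeasure ?M {x<..} = emeasure ?N {x<..}" for x
  proof -
    consider "x < 0" | "0 \<le> x" "x < r\<^sup>2" | "r\<^sup>2 \<le> x" by linarith
    then show ?thesis
    proof cases
      case 1
      then have "ball (0::complex) r \<inter> {z. x < (cmod z)\<^sup>2} = ball 0 r"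
        using zero_le_power2 by (auto intro: less_le_trans)
      moreover have "{0<..<r\<^sup>2} \<inter> {x<..} = {0<..<r\<^sup>2}" using 1 by auto
      ultimately show ?thesis
        unfolding M N using assms by (simp add: emeasure_ball unit_ball_vol_2 flip: ennreal_mult)
    next
      case 2
      have "cmod z \<le> sqrt x \<longleftrightarrow> (cmod z)\<^sup>2 \<le> x" for z
        using real_sqrt_le_iff[of "(cmod z)\<^sup>2" x] by simp
      then have "ball (0::complex) r \<inter> {z. x < (cmod z)\<^sup>2} = ball 0 r - cball 0 (sqrt x)"
        by (auto simp: not_le[symmetric])
      moreover have "{0<..<r\<^sup>2} \<inter> {x<..} = {x<..<r\<^sup>2}" using 2 by auto
      moreover have "sqrt x < r" using 2 assms by (simp add: real_less_lsqrt)
      ultimately show ?thesis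
        unfolding M N using 2 by (simp add: emeasure_annulus flip: ennreal_mult)
    next
      case 3
      have "(cmod z)\<^sup>2 < r\<^sup>2" if "cmod z < r" for z using that by (simp add: power_strict_mono)
      then have "ball (0::complex) r \<inter> {z. x < (cmod z)\<^sup>2} = {}" using 3 by fastforce
      moreover have "{0<..<r\<^sup>2} \<inter> {x<..} = {}" using 3 by auto
      ultimately show ?thesis unfolding M N by simp
    qed
  qed
  fix x
  show "emeasure ?M {x<..} = emeasure ?N {x<..}" by (rule eq)
  show "emeasure ?M {x<..} < \<infinity>"
  proof -
    have "emeasure lborel ({0<..<r\<^sup>2} \<inter> {x<..}) \<le> emeasure lborel {0<..<r\<^sup>2}" by (intro emeasure_mono) auto
    also have "\<dots> < \<infinity>" by simp
    finally show ?thesis unfolding eq N by (simp add: ennreal_mult_less_top)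
  qed
qed auto

text \<open>The substitution \<open>t = (cmod z)\<^sup>2\<close>, in place of polar coordinates,
  turns area into \<open>pi\<close> times length.\<close>

lemma radial_integral:
  fixes g :: "real \<Rightarrow> real"
  assumes r: "0 < r" and g: "g \<in> borel_measurable borel"
  shows "set_integrable lborel (ball (0::complex) r) (\<lambda>z. g ((cmod z)\<^sup>2)) \<longleftrightarrow> set_integrable lborel {0<..<r\<^sup>2} g"
    and "(LINT z:ball (0::complex) r|lborel. g ((cmod z)\<^sup>2)) = pi * (LINT t:{0<..<r\<^sup>2}|lborel. g t)"
proof -
  let ?D = "density lborel (indicator (ball (0::complex) r))"
  let ?N = "density lborel (\<lambda>t. ennreal (pi * indicator {0<..<r\<^sup>2} t))"
  have D: "?D = density lborel (\<lambda>z. ennreal (indicator (ball 0 r) z))" by (simp add: ennreal_indicator)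
  have m2: "(\<lambda>z::complex. (cmod z)\<^sup>2) \<in> borel_measurable ?D" by measurable
  have gm: "(\<lambda>z::complex. g ((cmod z)\<^sup>2)) \<in> borel_measurable lborel" using g by measurable
  have "set_integrable lborel (ball (0::complex) r) (\<lambda>z. g ((cmod z)\<^sup>2)) \<longleftrightarrow> integrable ?D (\<lambda>z. g ((cmod z)\<^sup>2))"
    unfolding D set_integrable_def by (subst integrable_density) (use gm in \<open>auto intro!: borel_measurable_indicator\<close>)
  also have "\<dots> \<longleftrightarrow> integrable (distr ?D borel (\<lambda>z. (cmod z)\<^sup>2)) g"
    by (subst integrable_distr_eq[OF m2 g]) simp
  also have "\<dots> \<longleftrightarrow> integrable ?N g" by (simp only: distr_ball_norm_square[OF r])
  also have "\<dots> \<longleftrightarrow> integrable lborel (\<lambda>t. (pi * indicator {0<..<r\<^sup>2} t) *\<^sub>R g t)"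
    by (subst integrable_density) (use g in auto)
  also have "\<dots> \<longleftrightarrow> set_integrable lborel {0<..<r\<^sup>2} g"
    unfolding set_integrable_def by (simp add: mult.assoc)
  finally show "set_integrable lborel (ball (0::complex) r) (\<lambda>z. g ((cmod z)\<^sup>2)) \<longleftrightarrow> set_integrable lborel {0<..<r\<^sup>2} g" .
  have "(LINT z:ball (0::complex) r|lborel. g ((cmod z)\<^sup>2)) = integral\<^sup>L ?D (\<lambda>z. g ((cmod z)\<^sup>2))"
    unfolding D set_lebesgue_integral_def by (subst integral_density) (use gm in \<open>auto intro!: borel_measurable_indicator\<close>)
  also have "\<dots> = integral\<^sup>L (distr ?D borel (\<lambda>z. (cmod z)\<^sup>2)) g"
    by (subst integral_distr[OF m2 g]) simp
  also have "\<dots> = integral\<^sup>L ?N g" by (simp only: distr_ball_norm_square[OF r])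
  also have "\<dots> = integral\<^sup>L lborel (\<lambda>t. (pi * indicator {0<..<r\<^sup>2} t) *\<^sub>R g t)"
    by (subst integral_density) (use g in auto)
  also have "\<dots> = pi * (LINT t:{0<..<r\<^sup>2}|lborel. g t)"
    unfolding set_lebesgue_integral_def by (simp add: mult.assoc)
  finally show "(LINT z:ball (0::complex) r|lborel. g ((cmod z)\<^sup>2)) = pi * (LINT t:{0<..<r\<^sup>2}|lborel. g t)" .
qed

text \<open>Measurability is stated for the function cut off to the disk because it is applied to
  expressions in \<open>f\<close>, which is arbitrary outside the unit disk.\<close>

lemma rotation_integral:
  fixes h :: "complex \<Rightarrow> real"
  assumes \<omega>: "cmod \<omega> = 1" and h: "(\<lambda>z. indicator (ball 0 r) z *\<^sub>R h z) \<in> borel_measurable borel"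
  shows "(LINT z:ball 0 r|lborel. h (\<omega> * z)) = (LINT z:ball 0 r|lborel. h z)"
proof -
  have "(LINT z:ball 0 r|lborel. h z) = (LINT z|distr lborel borel (\<lambda>z. \<omega> * z). indicator (ball 0 r) z *\<^sub>R h z)"
    by (simp add: distr_lborel_rotation[OF \<omega>] set_lebesgue_integral_def)
  also have "\<dots> = (LINT z|lborel. indicator (ball 0 r) (\<omega> * z) *\<^sub>R h (\<omega> * z))"
    by (rule integral_distr) (use h in measurable)
  also have "\<dots> = (LINT z:ball 0 r|lborel. h (\<omega> * z))"
    unfolding set_lebesgue_integral_def
    by (rule Bochner_Integration.integral_cong) (auto simp: norm_mult \<omega> split: split_indicator)
  finally show ?thesis by simp
qed

subsection \<open>Area integral means\<close>

lemma disk_integrable: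
  fixes h :: "complex \<Rightarrow> real"
  assumes "continuous_on (ball 0 1) h" "r < 1"
  shows "set_integrable lborel (ball 0 r) (\<lambda>z. h z * (1 - (cmod z)\<^sup>2) powr b)"
proof -
  have "1 - (cmod z)\<^sup>2 > 0" if "cmod z \<le> r" for z :: complex
    using power_strict_mono[of "cmod z" 1 2] that assms(2) by simp
  then have "continuous_on (cball 0 r) (\<lambda>z. h z * (1 - (cmod z)\<^sup>2) powr b)"
    by (intro continuous_intros continuous_on_subset[OF assms(1)]) (use assms(2) in \<open>auto simp: less_imp_neq\<close>)
  then have "set_integrable lborel (cball 0 r) (\<lambda>z. h z * (1 - (cmod z)\<^sup>2) powr b)"
    unfolding set_integrable_def by (intro borel_integrable_compact) auto
  then show ?thesis by (rule set_integrable_subset) auto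
qed

lemma weighted_area_integral:
  fixes h :: "complex \<Rightarrow> real"
  assumes h: "continuous_on (ball 0 1) h" and r: "r \<le> 1"
  shows "(LINT z:ball 0 r|weighted_area \<alpha>. h z) = (LINT z:ball 0 r|lborel. h z * (1 - (cmod z)\<^sup>2) powr \<alpha>)"
proof -
  let ?w = "\<lambda>z::complex. indicator (ball 0 1) z * (1 - (cmod z)\<^sup>2) powr \<alpha> :: real"
  have W: "weighted_area \<alpha> = density lborel (\<lambda>z. ennreal (?w z))"
    unfolding weighted_area_def by (intro arg_cong[where f = "density lborel"] ext) (auto split: split_indicator)
  have "continuous_on (ball 0 r) h" by (rule continuous_on_subset[OF h]) (use r in auto)
  then have m: "(\<lambda>z. indicator (ball 0 r) z *\<^sub>R h z) \<in> borel_measurable borel"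
    by (intro borel_measurable_continuous_on_indicator) auto
  have [measurable]: "ball (0::complex) 1 \<in> sets borel" by simp
  have w: "?w \<in> borel_measurable borel" by measurable
  have "(LINT z:ball 0 r|weighted_area \<alpha>. h z) = (LINT z|lborel. ?w z *\<^sub>R (indicator (ball 0 r) z *\<^sub>R h z))"
    unfolding set_lebesgue_integral_def W by (rule integral_density) (use m w in auto)
  also have "\<dots> = (LINT z:ball 0 r|lborel. h z * (1 - (cmod z)\<^sup>2) powr \<alpha>)"
    unfolding set_lebesgue_integral_def
    by (rule Bochner_Integration.integral_cong) (use r in \<open>auto split: split_indicator\<close>)
  finally show ?thesis .
qed

lemma measure_weighted_area:
  assumes r: "0 < r" "r < 1"
  shows "measure (weighted_area (- a)) (ball 0 r) = pi * inc_beta a 0 (r\<^sup>2)"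
proof -
  have "measure (weighted_area (- a)) (ball 0 r) = (LINT z:ball 0 r|weighted_area (- a). 1)"
    by (simp add: set_lebesgue_integral_def weighted_area_def)
  also have "\<dots> = (LINT z:ball 0 r|lborel. 1 * (1 - (cmod z)\<^sup>2) powr (- a))"
    by (rule weighted_area_integral) (use r in auto)
  also have "\<dots> = pi * (LINT t:{0<..<r\<^sup>2}|lborel. (1 - t) powr (- a))"
    using radial_integral(2)[of r "\<lambda>t. (1 - t) powr (- a)"] r by simp
  also have "(LINT t:{0<..<r\<^sup>2}|lborel. (1 - t) powr (- a)) = inc_beta a 0 (r\<^sup>2)"
    unfolding inc_beta_def set_lebesgue_integral_def
    by (rule Bochner_Integration.integral_cong) (auto split: split_indicator)
  finally show ?thesis .
qed

text \<open>Disk and weight are invariant under rotation, so each of the \<open>n\<close> summands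
  contributes the same integral. Replacing \<open>cmod (f z) powr p\<close> by its root mean leaves
  the area integral unchanged.\<close>

lemma root_mean_integral:
  assumes f: "f holomorphic_on ball 0 1" "0 < p" "0 < n" and r: "r < 1"
  shows "(LINT z:ball 0 r|lborel. root_mean p f n z * (1 - (cmod z)\<^sup>2) powr b)
    = (LINT z:ball 0 r|lborel. cmod (f z) powr p * (1 - (cmod z)\<^sup>2) powr b)"
proof -
  define H where "H z = cmod (f z) powr p * (1 - (cmod z)\<^sup>2) powr b" for z
  let ?J = "{\<omega>::complex. \<omega> ^ n = 1}"
  have J: "card ?J = n" "finite ?J"
    using card_roots_unity_eq[OF f(3)] finite_roots_unity[of n] f(3) by auto
  have one: "cmod \<omega> = 1" if "\<omega> \<in> ?J" for \<omega> using that norm_root_unity f(3) by auto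
  have H_int: "set_integrable lborel (ball 0 r) H"
    unfolding H_def by (rule disk_integrable[OF continuous_on_powr_norm[OF f(1,2)] r])
  have int: "set_integrable lborel (ball 0 r) (\<lambda>z. H (\<omega> * z))" if "\<omega> \<in> ?J" for \<omega>
  proof -
    have "set_integrable lborel (ball 0 r) (\<lambda>z. cmod (f (\<omega> * z)) powr p * (1 - (cmod z)\<^sup>2) powr b)"
      by (rule disk_integrable[OF continuous_on_powr_norm[OF holomorphic_on_rotate[OF f(1) one[OF that]] f(2)] r])
    then show ?thesis by (simp add: H_def norm_mult one[OF that])
  qed
  have "(LINT z:ball 0 r|lborel. root_mean p f n z * (1 - (cmod z)\<^sup>2) powr b)
      = (LINT z:ball 0 r|lborel. (\<Sum>\<omega>\<in>?J. H (\<omega> * z)) / real n)"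
    by (intro arg_cong[where f = "set_lebesgue_integral lborel (ball 0 r)"] ext)
      (simp add: root_mean_def H_def norm_mult one sum_distrib_right)
  also have "\<dots> = (LINT z:ball 0 r|lborel. (\<Sum>\<omega>\<in>?J. H (\<omega> * z))) / real n"
    by (rule set_integral_divide_zero)
  also have "(LINT z:ball 0 r|lborel. (\<Sum>\<omega>\<in>?J. H (\<omega> * z))) = (\<Sum>\<omega>\<in>?J. LINT z:ball 0 r|lborel. H (\<omega> * z))"
    unfolding set_lebesgue_integral_def scaleR_sum_right
    by (rule Bochner_Integration.integral_sum) (use int in \<open>simp add: set_integrable_def\<close>)
  also have "\<dots> = (\<Sum>\<omega>\<in>?J. LINT z:ball 0 r|lborel. H z)"
    using H_int by (intro sum.cong refl rotation_integral one) (auto simp: set_integrable_def)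
  also have "\<dots> / real n = (LINT z:ball 0 r|lborel. H z)" using J f(3) by simp
  finally show ?thesis by (simp add: H_def)
qed

lemma circle_max_integrable:
  assumes f: "f holomorphic_on ball 0 1" "0 < p" "0 < n" and R: "0 < R" "R < 1"
  shows "set_integrable lborel {0<..<R\<^sup>2} (\<lambda>t. circle_max p f n (sqrt t) * (1 - t) powr (-a))"
    and "set_integrable lborel (ball 0 R) (\<lambda>z. circle_max p f n (cmod z) * (1 - (cmod z)\<^sup>2) powr (-a))"
    and "(LINT z:ball 0 R|lborel. circle_max p f n (cmod z) * (1 - (cmod z)\<^sup>2) powr (-a))
      = pi * (LINT t:{0<..<R\<^sup>2}|lborel. circle_max p f n (sqrt t) * (1 - t) powr (-a))"
proof -
  \<comment> \<open>Clamping the radius to \<open>{0..R}\<close> makes \<open>m\<close> monotone on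
    the whole line, hence Borel measurable; on \<open>{0<..<R\<^sup>2}\<close> it agrees with
    \<open>circle_max p f n (sqrt t)\<close>.\<close>
  define m where "m t = circle_max p f n (min (sqrt (max t 0)) R)" for t
  define g where "g t = m t * (1 - t) powr (-a)" for t
  have "mono m"
    unfolding m_def by (intro monoI circle_max_mono f) (use R in \<open>auto intro: min.coboundedI1\<close>)
  then have [measurable]: "m \<in> borel_measurable borel" by (rule borel_measurable_mono)
  have g: "g \<in> borel_measurable borel" unfolding g_def by measurable
  have sq: "t < R\<^sup>2 \<Longrightarrow> sqrt t < R" for t using R by (simp add: real_less_lsqrt)
  have g_eq: "g t = circle_max p f n (sqrt t) * (1 - t) powr (-a)" if "t \<in> {0<..<R\<^sup>2}" for t
    using that sq[of t] by (simp add: g_def m_def max_def min_def)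
  have g_norm: "g ((cmod z)\<^sup>2) = circle_max p f n (cmod z) * (1 - (cmod z)\<^sup>2) powr (-a)" if "z \<in> ball 0 R" for z
    using that R by (auto simp: g_def m_def max_def min_def)
  have R2: "R\<^sup>2 < 1" using power_strict_mono[of R 1 2] R by simp
  have "set_integrable lborel {0<..<R\<^sup>2} g"
  proof (rule set_integrable_bound)
    show "set_integrable lborel {0<..<R\<^sup>2} (\<lambda>t. m (R\<^sup>2) * (t powr 0 * (1 - t) powr (-a)))"
      by (intro set_integrable_mult_right inc_beta_integrable) (use R2 in auto)
    show "set_borel_measurable lborel {0<..<R\<^sup>2} g"
      using g by (auto simp: set_borel_measurable_def)
    have "norm (g t) \<le> norm (m (R\<^sup>2) * (t powr 0 * (1 - t) powr (-a)))" if "t \<in> {0<..<R\<^sup>2}" for t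
    proof -
      have "0 \<le> m t" unfolding m_def by (rule circle_max_nonneg[OF f]) (use R in auto)
      moreover have "m t \<le> m (R\<^sup>2)" using monoD[OF \<open>mono m\<close>, of t "R\<^sup>2"] that by simp
      ultimately show ?thesis using that by (auto simp: g_def abs_mult intro!: mult_right_mono)
    qed
    then show "AE t in lborel. t \<in> {0<..<R\<^sup>2} \<longrightarrow> norm (g t) \<le> norm (m (R\<^sup>2) * (t powr 0 * (1 - t) powr (-a)))"
      by simp
  qed
  then show int: "set_integrable lborel {0<..<R\<^sup>2} (\<lambda>t. circle_max p f n (sqrt t) * (1 - t) powr (-a))"
    using g_eq by (subst set_integrable_cong[OF refl refl]) auto
  have "set_integrable lborel (ball (0::complex) R) (\<lambda>z. g ((cmod z)\<^sup>2))"
    unfolding radial_integral(1)[OF R(1) g] by fact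
  then show "set_integrable lborel (ball 0 R) (\<lambda>z. circle_max p f n (cmod z) * (1 - (cmod z)\<^sup>2) powr (-a))"
    using g_norm by (subst set_integrable_cong[OF refl refl]) auto
  have "(LINT z:ball 0 R|lborel. circle_max p f n (cmod z) * (1 - (cmod z)\<^sup>2) powr (-a)) = (LINT z:ball 0 R|lborel. g ((cmod z)\<^sup>2))"
    by (rule set_lebesgue_integral_cong) (auto simp: g_norm)
  also have "\<dots> = pi * (LINT t:{0<..<R\<^sup>2}|lborel. g t)" by (rule radial_integral(2)[OF R(1) g])
  also have "(LINT t:{0<..<R\<^sup>2}|lborel. g t) = (LINT t:{0<..<R\<^sup>2}|lborel. circle_max p f n (sqrt t) * (1 - t) powr (-a))"
    by (rule set_lebesgue_integral_cong) (auto simp: g_eq)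
  finally show "(LINT z:ball 0 R|lborel. circle_max p f n (cmod z) * (1 - (cmod z)\<^sup>2) powr (-a))
      = pi * (LINT t:{0<..<R\<^sup>2}|lborel. circle_max p f n (sqrt t) * (1 - t) powr (-a))" .
qed

section \<open>Positivity and log-convexity of the area means\<close>

lemma area_mean_altdef:
  assumes f: "f holomorphic_on ball 0 1" "0 < p" and r: "0 < r" "r < 1"
  shows "area_mean p (- a) f r
    = (LINT z:ball 0 r|lborel. cmod (f z) powr p * (1 - (cmod z)\<^sup>2) powr (-a)) / (pi * inc_beta a 0 (r\<^sup>2))"
  unfolding area_mean_def measure_weighted_area[OF r]
  using r by (subst weighted_area_integral[OF continuous_on_powr_norm[OF f]]) auto

text \<open>If the integral vanished, \<open>f\<close> would be 0 almost everywhere on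
  \<open>ball 0 r\<close>. The set of its nonzeros there is open and of measure 0, hence empty, and
  the identity theorem makes \<open>f\<close> vanish on the unit disk.\<close>

lemma area_mean_pos:
  assumes f: "f holomorphic_on ball 0 1" "0 < p" and r: "0 < r" "r < 1"
    and nz: "\<exists>z\<in>ball 0 1. f z \<noteq> 0"
  shows "0 < area_mean p (- a) f r"
proof -
  define H where "H z = cmod (f z) powr p * (1 - (cmod z)\<^sup>2) powr (-a)" for z
  have int: "set_integrable lborel (ball 0 r) H"
    unfolding H_def by (rule disk_integrable[OF continuous_on_powr_norm[OF f] r(2)])
  have nn: "AE z in lborel. 0 \<le> indicator (ball 0 r) z *\<^sub>R H z"
    by (intro AE_I2) (auto simp: H_def split: split_indicator)
  have "0 \<le> (LINT z:ball 0 r|lborel. H z)"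
    unfolding set_lebesgue_integral_def by (rule integral_nonneg_AE[OF nn])
  moreover have "(LINT z:ball 0 r|lborel. H z) \<noteq> 0"
  proof
    assume "(LINT z:ball 0 r|lborel. H z) = 0"
    then have "AE z in lborel. indicator (ball 0 r) z *\<^sub>R H z = 0"
      using integral_nonneg_eq_0_iff_AE[OF int[unfolded set_integrable_def] nn]
      by (simp add: set_lebesgue_integral_def)
    then have "AE z in lborel. z \<in> ball 0 r \<longrightarrow> f z = 0"
    proof eventually_elim
      fix z :: complex assume z: "indicator (ball 0 r) z *\<^sub>R H z = 0"
      show "z \<in> ball 0 r \<longrightarrow> f z = 0"
      proof
        assume zr: "z \<in> ball 0 r"
        then have "(cmod z)\<^sup>2 < 1" using power_strict_mono[of "cmod z" 1 2] r by simp
        then show "f z = 0" using z zr by (simp add: H_def)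
      qed
    qed
    then have zero: "f z = 0" if "z \<in> ball 0 r" for z
    proof -
      have "open {z \<in> ball 0 r. f z \<noteq> 0}"
      proof -
        have "continuous_on (ball 0 r) f"
          by (intro holomorphic_on_imp_continuous_on holomorphic_on_subset[OF f(1)]) (use r in auto)
        then have "open (ball 0 r \<inter> f -` (- {0}))"
          by (intro continuous_open_preimage) auto
        moreover have "ball 0 r \<inter> f -` (- {0}) = {z \<in> ball 0 r. f z \<noteq> 0}" by auto
        ultimately show ?thesis by (simp only:)
      qed
      moreover have "emeasure lborel {z \<in> ball 0 r. f z \<noteq> 0} = 0"
        using \<open>AE z in lborel. z \<in> ball 0 r \<longrightarrow> f z = 0\<close> calculation
        by (subst (asm) AE_iff_measurable[of "{z \<in> ball 0 r. f z \<noteq> 0}"]) auto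
      ultimately have "{z \<in> ball 0 r. f z \<noteq> 0} = {}"
        using open_not_negligible[of "{z \<in> ball 0 r. f z \<noteq> 0}"]
        by (auto simp: negligible_iff_null_sets null_sets_def simp del: Collect_empty_eq)
      then show ?thesis using that by blast
    qed
    have "f z = 0" if "z \<in> ball 0 1" for z
    proof (rule analytic_continuation[OF f(1)])
      show "ball 0 r \<subseteq> ball (0::complex) 1" using r by auto
      show "(0::complex) islimpt ball 0 r"
        by (rule interior_limit_point) (use r in \<open>simp add: interior_open\<close>)
    qed (use that zero in auto)
    then show False using nz by blast
  qed
  ultimately have "0 < (LINT z:ball 0 r|lborel. H z)" by simp
  moreover have "0 < inc_beta a 0 (r\<^sup>2)"
    using power_strict_mono[of r 1 2] r by (intro inc_beta_pos) auto
  ultimately show ?thesis unfolding area_mean_altdef[OF f r] by (simp add: H_def)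
qed

text \<open>For suitable \<open>n\<close> the radial function \<open>circle_max p f n\<close>
  exceeds the root mean by at most \<open>\<epsilon>\<close>, so its normalized integral lies
  between the area mean and the area mean plus \<open>\<epsilon>\<close>. The lower bound is used at
  \<open>r\<close>, the upper bound at \<open>r1\<close> and \<open>r2\<close>, and
  \<open>log_convex_quotient\<close> connects them.\<close>

lemma area_mean_log_convex_approx:
  assumes f: "f holomorphic_on ball 0 1" "0 < p" and a: "0 \<le> a" "a \<le> 2"
    and r: "0 < r1" "r1 < r2" "r2 < 1" "0 < \<theta>" "\<theta> < 1" "r = r1 powr \<theta> * r2 powr (1 - \<theta>)"
    and pos: "0 < area_mean p (- a) f r1" and "0 < \<epsilon>"
  shows "area_mean p (- a) f r
    \<le> (area_mean p (- a) f r1 + \<epsilon>) powr \<theta> * (area_mean p (- a) f r2 + \<epsilon>) powr (1 - \<theta>)"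
proof -
  obtain n where n: "0 < n"
    and near: "\<And>z. cmod z \<le> r2 \<Longrightarrow> circle_max p f n (cmod z) \<le> root_mean p f n z + \<epsilon>"
    using circle_max_le_root_mean[OF f r(3) \<open>0 < \<epsilon>\<close>] by blast
  define I where "I y = (LINT t:{0<..<y}|lborel. circle_max p f n (sqrt t) * (1 - t) powr (-a))" for y
  have bounds: "area_mean p (- a) f y \<le> I (y\<^sup>2) / inc_beta a 0 (y\<^sup>2)"
      "I (y\<^sup>2) / inc_beta a 0 (y\<^sup>2) \<le> area_mean p (- a) f y + \<epsilon>" if y: "0 < y" "y \<le> r2" for y
  proof -
    have y1: "y < 1" using y r by simp
    define w where "w z = (1 - (cmod z)\<^sup>2) powr (-a)" for z :: complex
    have B: "0 < inc_beta a 0 (y\<^sup>2)"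
      using power_strict_mono[of y 1 2] y(1) y1 by (intro inc_beta_pos) auto
    have I: "(LINT z:ball 0 y|lborel. circle_max p f n (cmod z) * w z) = pi * I (y\<^sup>2)"
      unfolding I_def w_def by (rule circle_max_integrable(3)[OF f n y(1) y1])
    have "(LINT z:ball 0 y|lborel. 1 * w z) = pi * inc_beta a 0 (y\<^sup>2)"
      unfolding w_def measure_weighted_area[OF y(1) y1, symmetric]
      by (subst weighted_area_integral[symmetric]) (use y1 in \<open>auto simp: set_lebesgue_integral_def weighted_area_def\<close>)
    then have J: "(LINT z:ball 0 y|lborel. w z) = pi * inc_beta a 0 (y\<^sup>2)" by simp
    have F: "(LINT z:ball 0 y|lborel. root_mean p f n z * w z) = area_mean p (- a) f y * (pi * inc_beta a 0 (y\<^sup>2))"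
      unfolding area_mean_altdef[OF f y(1) y1] w_def
      by (subst root_mean_integral[OF f n y1]) (use B in auto)
    have int1: "set_integrable lborel (ball 0 y) (\<lambda>z. root_mean p f n z * w z)"
      unfolding w_def by (rule disk_integrable[OF continuous_on_root_mean[OF f n] y1])
    have int2: "set_integrable lborel (ball 0 y) (\<lambda>z. circle_max p f n (cmod z) * w z)"
      unfolding w_def by (rule circle_max_integrable(2)[OF f n y(1) y1])
    have "set_integrable lborel (ball 0 y) (\<lambda>z. 1 * w z)"
      unfolding w_def by (rule disk_integrable[OF continuous_on_const y1])
    then have int3: "set_integrable lborel (ball 0 y) w" by simp
    have "area_mean p (- a) f y * (pi * inc_beta a 0 (y\<^sup>2)) \<le> pi * I (y\<^sup>2)"
      unfolding F[symmetric] I[symmetric]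
      by (rule set_integral_mono[OF int1 int2])
        (use y1 in \<open>auto simp: w_def intro!: mult_right_mono root_mean_le_circle_max[OF f n]\<close>)
    then show "area_mean p (- a) f y \<le> I (y\<^sup>2) / inc_beta a 0 (y\<^sup>2)"
      using B by (simp add: field_simps)
    have "pi * I (y\<^sup>2) \<le> (LINT z:ball 0 y|lborel. root_mean p f n z * w z + \<epsilon> * w z)"
      unfolding I[symmetric]
    proof (rule set_integral_mono[OF int2])
      show "set_integrable lborel (ball 0 y) (\<lambda>z. root_mean p f n z * w z + \<epsilon> * w z)"
        using int1 int3 by (intro set_integral_add set_integrable_mult_right) auto
      fix z :: complex assume "z \<in> ball 0 y"
      then have "circle_max p f n (cmod z) * w z \<le> (root_mean p f n z + \<epsilon>) * w z"
        using y by (intro mult_right_mono near) (auto simp: w_def)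
      then show "circle_max p f n (cmod z) * w z \<le> root_mean p f n z * w z + \<epsilon> * w z"
        by (simp add: distrib_right)
    qed
    also have "\<dots> = area_mean p (- a) f y * (pi * inc_beta a 0 (y\<^sup>2)) + \<epsilon> * (pi * inc_beta a 0 (y\<^sup>2))"
      using int1 int3 by (subst set_integral_add) (auto intro!: set_integrable_mult_right simp: F J)
    also have "\<dots> = pi * ((area_mean p (- a) f y + \<epsilon>) * inc_beta a 0 (y\<^sup>2))"
      by (simp add: algebra_simps)
    finally have "I (y\<^sup>2) \<le> (area_mean p (- a) f y + \<epsilon>) * inc_beta a 0 (y\<^sup>2)"
      by (simp only: mult_le_cancel_left_pos[OF pi_gt_zero])
    then show "I (y\<^sup>2) / inc_beta a 0 (y\<^sup>2) \<le> area_mean p (- a) f y + \<epsilon>"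
      by (simp only: pos_divide_le_eq[OF B])
  qed
  have rr: "0 < r" "r \<le> r2"
  proof -
    show "0 < r" using r by simp
    have "r \<le> r2 powr \<theta> * r2 powr (1 - \<theta>)"
      unfolding r(6) using r by (intro mult_right_mono powr_mono2) auto
    also have "\<dots> = r2" using r by (simp flip: powr_add)
    finally show "r \<le> r2" .
  qed
  have B1: "0 < inc_beta a 0 (r1\<^sup>2)"
    using power_strict_mono[of r1 1 2] r by (intro inc_beta_pos) auto
  have "0 < I (r1\<^sup>2) / inc_beta a 0 (r1\<^sup>2)"
    by (rule less_le_trans[OF pos bounds(1)]) (use r in auto)
  then have I1: "0 < I (r1\<^sup>2)" using B1 by (simp add: zero_less_divide_iff)
  have "area_mean p (- a) f r \<le> I (r\<^sup>2) / inc_beta a 0 (r\<^sup>2)" by (rule bounds(1)[OF rr])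
  also have "\<dots> \<le> (I (r1\<^sup>2) / inc_beta a 0 (r1\<^sup>2)) powr \<theta> * (I (r2\<^sup>2) / inc_beta a 0 (r2\<^sup>2)) powr (1 - \<theta>)"
    unfolding I_def
  proof (rule log_convex_quotient[OF a])
    show "0 < r1\<^sup>2" "r1\<^sup>2 < r2\<^sup>2" "r2\<^sup>2 < 1"
      using r power_strict_mono[of r1 r2 2] power_strict_mono[of r2 1 2] by auto
    show "r\<^sup>2 = (r1\<^sup>2) powr \<theta> * (r2\<^sup>2) powr (1 - \<theta>)"
      using r by (simp add: power2_eq_square powr_mult)
    show "set_integrable lborel {0<..<r2\<^sup>2} (\<lambda>t. circle_max p f n (sqrt t) * (1 - t) powr (-a))"
      by (rule circle_max_integrable(1)[OF f n]) (use r in auto)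
    show "0 < (LINT t:{0<..<r1\<^sup>2}|lborel. circle_max p f n (sqrt t) * (1 - t) powr (-a))"
      using I1 by (simp add: I_def)
  next
    fix t u :: real assume "0 < t" "t \<le> u" "u < 1"
    then show "circle_max p f n (sqrt t) \<le> circle_max p f n (sqrt u)"
      by (intro circle_max_mono[OF f n]) auto
  next
    fix c s t u v :: real
    assume t: "0 < t" "t < u" "u < v" "v < 1"
      and c: "circle_max p f n (sqrt t) \<le> c * t powr s" "circle_max p f n (sqrt v) \<le> c * v powr s"
    \<comment> \<open>The comparison runs in \<open>t = r\<^sup>2\<close>, so exponent
      \<open>s\<close> there corresponds to \<open>2 * s\<close> in the radius.\<close>
    have pw: "y powr s = sqrt y powr (2 * s)" if "0 < y" for y :: real
      using that by (simp add: powr_half_sqrt[symmetric] powr_powr)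
    show "circle_max p f n (sqrt u) \<le> c * u powr s"
      using c t circle_max_between[OF f n, of "sqrt t" "sqrt u" "sqrt v" c "2 * s"] by (simp add: pw)
  qed (use r in auto)
  also have "\<dots> \<le> (area_mean p (- a) f r1 + \<epsilon>) powr \<theta> * (area_mean p (- a) f r2 + \<epsilon>) powr (1 - \<theta>)"
  proof (intro mult_mono powr_mono2)
    have "0 \<le> area_mean p (- a) f r2"
      unfolding area_mean_def set_lebesgue_integral_def by (intro divide_nonneg_nonneg integral_nonneg_AE AE_I2) auto
    then show "0 \<le> I (r2\<^sup>2) / inc_beta a 0 (r2\<^sup>2)"
      by (rule order_trans[OF _ bounds(1)]) (use r in auto)
    show "0 \<le> I (r1\<^sup>2) / inc_beta a 0 (r1\<^sup>2)" using I1 B1 by simp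
  qed (use r bounds in auto)
  finally show ?thesis .
qed

text \<open>Let \<open>\<epsilon>\<close> tend to 0 from above; a power with positive exponent is
  continuous on the nonnegative reals.\<close>

lemma area_mean_log_convex:
  assumes f: "f holomorphic_on ball 0 1" "0 < p" and a: "0 \<le> a" "a \<le> 2"
    and r: "0 < r1" "r1 < r2" "r2 < 1" "0 < \<theta>" "\<theta> < 1" "r = r1 powr \<theta> * r2 powr (1 - \<theta>)"
    and pos: "0 < area_mean p (- a) f r1"
  shows "area_mean p (- a) f r \<le> area_mean p (- a) f r1 powr \<theta> * area_mean p (- a) f r2 powr (1 - \<theta>)"
proof (rule tendsto_lowerbound)
  show "((\<lambda>\<epsilon>. (area_mean p (- a) f r1 + \<epsilon>) powr \<theta> * (area_mean p (- a) f r2 + \<epsilon>) powr (1 - \<theta>))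
      \<longlongrightarrow> area_mean p (- a) f r1 powr \<theta> * area_mean p (- a) f r2 powr (1 - \<theta>)) (at_right 0)"
  proof (intro tendsto_mult)
    have "0 \<le> area_mean p (- a) f y" for y
      unfolding area_mean_def set_lebesgue_integral_def by (intro divide_nonneg_nonneg integral_nonneg_AE AE_I2) auto
    then have "((\<lambda>\<epsilon>. (area_mean p (- a) f y + \<epsilon>) powr s) \<longlongrightarrow> (area_mean p (- a) f y + 0) powr s) (at_right 0)"
      if "0 < s" for s y
      by (intro tendsto_powr' tendsto_intros) (use that in \<open>auto simp: eventually_at_right_field intro!: exI[of _ 1] add_nonneg_nonneg less_imp_le\<close>)
    then show "((\<lambda>\<epsilon>. (area_mean p (- a) f r1 + \<epsilon>) powr \<theta>) \<longlongrightarrow> area_mean p (- a) f r1 powr \<theta>) (at_right 0)"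
      "((\<lambda>\<epsilon>. (area_mean p (- a) f r2 + \<epsilon>) powr (1 - \<theta>)) \<longlongrightarrow> area_mean p (- a) f r2 powr (1 - \<theta>)) (at_right 0)"
      using r by auto
  qed
  show "\<forall>\<^sub>F \<epsilon> in at_right 0. area_mean p (- a) f r
      \<le> (area_mean p (- a) f r1 + \<epsilon>) powr \<theta> * (area_mean p (- a) f r2 + \<epsilon>) powr (1 - \<theta>)"
    unfolding eventually_at_right_field
    using area_mean_log_convex_approx[OF f a r pos] by (intro exI[of _ 1]) auto
qed simp

theorem theorem1:
  fixes p \<alpha> :: real and f :: "complex \<Rightarrow> complex"
  assumes "0 < p"
    and "-2 \<le> \<alpha>" and "\<alpha> \<le> 0"
    and "f analytic_on ball 0 1"
  shows "((\<exists>z\<in>ball 0 1. f z \<noteq> 0) \<longrightarrow> logarithmically_convex (area_mean p \<alpha> f)) \<and>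
    (\<forall>r1 r2 \<theta> r :: real. 0 < r1 \<and> r1 < r2 \<and> r2 < 1 \<and> 0 < \<theta> \<and> \<theta> < 1 \<and>
       r = r1 powr \<theta> * r2 powr (1 - \<theta>) \<longrightarrow>
       area_mean p \<alpha> f r \<le> area_mean p \<alpha> f r1 powr \<theta> * area_mean p \<alpha> f r2 powr (1 - \<theta>))"
proof (intro conjI impI allI)
  have f: "f holomorphic_on ball 0 1" "0 < p"
    using assms analytic_imp_holomorphic by auto
  have a: "0 \<le> - \<alpha>" "- \<alpha> \<le> 2" using assms by auto
  have le: "area_mean p \<alpha> f r \<le> area_mean p \<alpha> f r1 powr \<theta> * area_mean p \<alpha> f r2 powr (1 - \<theta>)"
    if "\<exists>z\<in>ball 0 1. f z \<noteq> 0" "0 < r1" "r1 < r2" "r2 < 1" "0 < \<theta>" "\<theta> < 1"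
      "r = r1 powr \<theta> * r2 powr (1 - \<theta>)" for r r1 r2 \<theta>
    using area_mean_log_convex[OF f a that(2-7)] area_mean_pos[OF f that(2) _ that(1), of "- \<alpha>"] that by simp
  {
    fix r1 r2 \<theta> r :: real
    assume r: "0 < r1 \<and> r1 < r2 \<and> r2 < 1 \<and> 0 < \<theta> \<and> \<theta> < 1 \<and> r = r1 powr \<theta> * r2 powr (1 - \<theta>)"
    show "area_mean p \<alpha> f r \<le> area_mean p \<alpha> f r1 powr \<theta> * area_mean p \<alpha> f r2 powr (1 - \<theta>)"
    proof (cases "\<exists>z\<in>ball 0 1. f z \<noteq> 0")
      case True
      then show ?thesis using le r by blast
    next
      case False
      \<comment> \<open>In this case \<open>f\<close> is known to vanish on the unit disk alone, so
        \<open>ball 0 r\<close> has to lie inside it. Then the mean at \<open>r\<close> is 0, and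
        the right-hand side is nonnegative.\<close>
      have "r < 1"
      proof -
        have "r \<le> r2 powr \<theta> * r2 powr (1 - \<theta>)"
          using r by (simp only:) (intro mult_right_mono powr_mono2, auto)
        also have "\<dots> = r2" using r by (simp flip: powr_add)
        finally show ?thesis using r by linarith
      qed
      then have "(LINT z:ball 0 r|weighted_area \<alpha>. cmod (f z) powr p) = (LINT z:ball 0 r|weighted_area \<alpha>. 0)"
        unfolding set_lebesgue_integral_def
        by (intro Bochner_Integration.integral_cong) (use False in \<open>auto split: split_indicator\<close>)
      then have "area_mean p \<alpha> f r = 0" by (simp add: area_mean_def)
      then show ?thesis by simp
    qed
  }
  assume nz: "\<exists>z\<in>ball 0 1. f z \<noteq> 0"
  have pos: "0 < area_mean p \<alpha> f r" if "0 < r" "r < 1" for r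
    using area_mean_pos[OF f that nz, of "- \<alpha>"] by simp
  show "logarithmically_convex (area_mean p \<alpha> f)"
    unfolding logarithmically_convex_def
  proof (intro conjI ballI)
    show "0 < area_mean p \<alpha> f r" if "r \<in> {0<..<1}" for r using that pos by simp
    show "convex_on {..<0} (\<lambda>t. ln (area_mean p \<alpha> f (exp t)))"
    proof (rule convex_on_linorderI)
      fix t x y :: real
      assume t: "0 < t" "t < 1" "x \<in> {..<0}" "y \<in> {..<0}" "x < y"
      let ?A = "area_mean p \<alpha> f"
      \<comment> \<open>Convexity with weight \<open>t\<close> on \<open>y\<close> is the
        multiplicative inequality for \<open>r1 = exp x\<close>, \<open>r2 = exp y\<close> and
        \<open>\<theta> = 1 - t\<close>.\<close>
      have "exp ((1 - t) * x + t * y) = exp x powr (1 - t) * exp y powr (1 - (1 - t))"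
        by (simp add: powr_def exp_add)
      then have "?A (exp ((1 - t) * x + t * y)) \<le> ?A (exp x) powr (1 - t) * ?A (exp y) powr (1 - (1 - t))"
        by (intro le[OF nz]) (use t in auto)
      moreover have "(1 - t) * x + t * y < 0"
        using t by (intro add_neg_neg mult_pos_neg) auto
      ultimately have "ln (?A (exp ((1 - t) * x + t * y))) \<le> ln (?A (exp x) powr (1 - t) * ?A (exp y) powr t)"
        using pos[of "exp x"] pos[of "exp y"] pos[of "exp ((1 - t) * x + t * y)"] t by simp
      also have "\<dots> = (1 - t) * ln (?A (exp x)) + t * ln (?A (exp y))"
        using pos[of "exp x"] pos[of "exp y"] t by (simp add: ln_mult ln_powr)
      finally show "ln (?A (exp ((1 - t) *\<^sub>R x + t *\<^sub>R y))) \<le> (1 - t) * ln (?A (exp x)) + t * ln (?A (exp y))"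
        by simp
    qed auto
  qed
qed

end
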